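(* Consider the state-dependent stochastic approximation (SA) iterates $\theta_{k+1}=\theta_k-\gamma_{k+1}\nabla\ell(\theta_k;z_{k+1})$, $z_{k+1}\sim P_{\theta_k}(z_k,\cdot)$, $k\ge 0$, and suppose that Assumptions A1–A6 listed in the context hold. Suppose $\epsilon<\mu/L$, and that the step sizes $\{\gamma_k\}_{k\ge1}$ are non-increasing and satisfy, for any $k\ge1$, $$\frac{\gamma_{k-1}}{\gamma_k}\le 1+\frac{\gamma_k(\mu-L\epsilon)}{4},\qquad \gamma_k\le\min\Big\{\frac{\mu-L\epsilon}{2L^2},\ \frac{\mu-L\epsilon}{2C_2},\ \frac{\min\{(\mu-L\epsilon)/3,\ 3\widehat L\}}{C_3+3\widehat L(\mu-L\epsilon)},\ \frac{1}{6\widehat L}\Big\}.$$ Then for any $k\ge1$, $$\mathbb E\big[\|\theta_k-\theta_{PS}\|^2\big]\le\prod_{i=1}^k\Big(1-\gamma_i\frac{\mu-L\epsilon}{2}\Big)\|\theta_0-\theta_{PS}\|^2+\mathsf C\,\gamma_k,$$ where $\mathbb E[\cdot]$ is the expectation over all the randomness in the algorithm and $$\mathsf C:=3\widehat L\,\overline\Delta+\frac{4\varsigma}{\mu-L\epsilon}\Big(2(2\sigma^2+C_1)+(\mu-L\epsilon)\widehat L+\big(C_3+3(\mu-L\epsilon)\widehat L\big)\overline\Delta\Big).$$ The constants $\varsigma, C_1,C_2,C_3,\overline\Delta,\widehat L$ are defined in the context.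
   Context: Setting. $\mathsf Z$ is a sample space (a measurable subset of a Euclidean space, with $\sigma$-algebra $\mathcal Z$). $\ell:\mathbb R^d\times\mathsf Z\to\mathbb R$ is a loss function, differentiable in its first argument; $\nabla\ell(\theta;z)$ is the gradient in $\theta$. For each $\theta\in\mathbb R^d$, $\mathcal D(\theta)$ is a probability distribution on $\mathsf Z$. Write $f(\theta_1;\theta_2)=\mathbb E_{z\sim\mathcal D(\theta_2)}[\ell(\theta_1;z)]$ and $\nabla f(\theta_1;\theta_2)=\mathbb E_{z\sim\mathcal D(\theta_2)}[\nabla\ell(\theta_1;z)]$. The performative stable solution $\theta_{PS}$ satisfies $\theta_{PS}=\arg\min_{\theta\in\mathbb R^d}\mathbb E_{z\sim\mathcal D(\theta_{PS})}[\ell(\theta;z)]$. For each $\theta$, $P_\theta:\mathsf Z\times\mathcal Z\to\mathbb R_+$ is a Markov transition kernel with unique stationary distribution equal to $\mathcal D(\theta)$; for a function $g$ on $\mathsf Z$, $P_\theta g(z)=\int_{\mathsf Z}g(z')P_\theta(z,dz')$. Algorithm. Given a deterministic $\theta_0\in\mathbb R^d$, an initial agent state $z_0\in\mathsf Z$ and positive step sizes $\{\gamma_k\}_{k\ge0}$: for $k=0,1,2,\dots$, given the past, draw $z_{k+1}\sim P_{\theta_k}(z_k,\cdot)$ and set $\theta_{k+1}=\theta_k-\gamma_{k+1}\nabla\ell(\theta_k;z_{k+1})$. Assumptions. A1 (strong convexity): there is $\mu>0$ with $\ell(\theta;z)\ge\ell(\theta';z)+\langle\nabla\ell(\theta';z),\theta-\theta'\rangle+\frac{\mu}{2}\|\theta'-\theta\|^2$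 for all $\theta,\theta'\in\mathbb R^d$, $z\in\mathsf Z$. A2: there is $L\ge0$ with $\|\nabla\ell(\theta;z)-\nabla\ell(\theta';z')\|\le L\{\|\theta-\theta'\|+\|z-z'\|\}$ for all $\theta,\theta'\in\mathbb R^d$, $z,z'\in\mathsf Z$. A3: there is $\sigma\ge0$ with $\sup_{z\in\mathsf Z}\|\nabla\ell(\theta;z)-\nabla f(\theta;\theta_{PS})\|\le\sigma(1+\|\theta-\theta_{PS}\|)$ for all $\theta\in\mathbb R^d$. A4 (Poisson equation): there is $\widehat{\nabla\ell}:\mathbb R^d\times\mathsf Z\to\mathbb R^d$ with $\nabla\ell(\theta';z)-\nabla f(\theta';\theta)=\widehat{\nabla\ell}(\theta';z)-P_\theta\widehat{\nabla\ell}(\theta';z)$ for all $\theta,\theta'\in\mathbb R^d$, $z\in\mathsf Z$, where $P_\theta\widehat{\nabla\ell}(\theta';z)=\int\widehat{\nabla\ell}(\theta';z')P_\theta(z,dz')$. A5: there is $L_{PH}\ge0$ with $\sup_{z\in\mathsf Z}\|P_\theta\widehat{\nabla\ell}(\theta;z)-P_{\theta'}\widehat{\nabla\ell}(\theta';z)\|\le L_{PH}\|\theta-\theta'\|$ for all $\theta,\theta'\in\mathbb R^d$. A6 ($\epsilon$-sensitivity): there is $\epsilon\ge0$ with $W_1(\mathcal D(\theta),\mathcal D(\theta'))=\inf_J\mathbb E_{(z,z')\sim J}[\|z-z'\|_1]\le\epsilon\|\theta-\theta'\|$ for all $\theta,\theta'$, the infimum being over all couplings $J$ of $\mathcal D(\theta)$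 and $\mathcal D(\theta')$. Constants. $\overline L,\widehat L>0$ are constants such that for all $z\in\mathsf Z$, $\theta\in\mathbb R^d$: $\|\nabla\ell(\theta;z)\|\le\overline L(1+\|\theta-\theta_{PS}\|)$ and $\max\{\|\widehat{\nabla\ell}(\theta;z)\|,\|P_\theta\widehat{\nabla\ell}(\theta;z)\|\}\le\widehat L(1+\|\theta-\theta_{PS}\|)$. Put $\tilde\mu=\mu-L\epsilon$, $\varsigma=1+\gamma_1\tilde\mu/4$, and $C_1=\varsigma L_{PH}\overline L+4\varsigma\overline L\widehat L+(1+\tilde\mu)\varsigma\widehat L$, $C_2=2\varsigma L_{PH}\overline L$, $C_3=C_1+2(1+\tilde\mu)\varsigma\widehat L$, $\overline\Delta=3\|\theta_0-\theta_{PS}\|^2+\frac{\varsigma}{9\widehat L^2}\big(2(2\sigma^2+C_1)+(\mu-L\epsilon)\widehat L\big)$. A step-size bound with zero denominator is read as $+\infty$. *)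

theory Defs
  imports "HOL-Probability.Probability"
begin

definition l1_norm :: "'b::euclidean_space \<Rightarrow> real" where
  "l1_norm x = (\<Sum>i\<in>Basis. \<bar>x \<bullet> i\<bar>)"

definition couplings :: "'b measure \<Rightarrow> 'b measure \<Rightarrow> ('b \<times> 'b) measure set" where
  "couplings M N =
     {J. sets J = sets (M \<Otimes>\<^sub>M N) \<and> distr J M fst = M \<and> distr J N snd = N}"

(* The transport cost is the l1 norm, whereas all other norms are Euclidean. *)
definition W1 :: "'b::euclidean_space measure \<Rightarrow> 'b measure \<Rightarrow> ennreal" where
  "W1 M N = (INF J\<in>couplings M N. \<integral>\<^sup>+ (z, z'). ennreal (l1_norm (z - z')) \<partial>J)"

definition stationary_distribution :: "'b measure \<Rightarrow> ('b \<Rightarrow> 'b measure) \<Rightarrow> 'b measure \<Rightarrow> bool" where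
  "stationary_distribution S K p \<longleftrightarrow> p \<in> space (prob_algebra S) \<and> p \<bind> K = p"

definition kernel_apply ::
    "('b \<Rightarrow> 'b measure) \<Rightarrow> ('b \<Rightarrow> 'a::{banach, second_countable_topology}) \<Rightarrow> 'b \<Rightarrow> 'a" where
  "kernel_apply K g z = (\<integral>z'. g z' \<partial>(K z))"

definition risk :: "('a \<Rightarrow> 'b \<Rightarrow> real) \<Rightarrow> ('a \<Rightarrow> 'b measure) \<Rightarrow> 'a \<Rightarrow> 'a \<Rightarrow> real" where
  "risk l D \<theta>\<^sub>1 \<theta>\<^sub>2 = (\<integral>z. l \<theta>\<^sub>1 z \<partial>(D \<theta>\<^sub>2))"

definition mean_grad ::
    "('a \<Rightarrow> 'b \<Rightarrow> 'a::euclidean_space) \<Rightarrow> ('a \<Rightarrow> 'b measure) \<Rightarrow> 'a \<Rightarrow> 'a \<Rightarrow> 'a" where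
  "mean_grad G D \<theta>\<^sub>1 \<theta>\<^sub>2 = (\<integral>z. G \<theta>\<^sub>1 z \<partial>(D \<theta>\<^sub>2))"

(* Integrability makes the minimised expectation meaningful: the Bochner integral of a
   non-integrable function is 0, which would make every point a minimiser. *)
definition performatively_stable :: "('a \<Rightarrow> 'b \<Rightarrow> real) \<Rightarrow> ('a \<Rightarrow> 'b measure) \<Rightarrow> 'a \<Rightarrow> bool" where
  "performatively_stable l D \<theta>\<^sub>P\<^sub>S \<longleftrightarrow>
     (\<forall>\<theta>. integrable (D \<theta>\<^sub>P\<^sub>S) (l \<theta>)) \<and>
     is_arg_min (\<lambda>\<theta>. risk l D \<theta> \<theta>\<^sub>P\<^sub>S) (\<lambda>_. True) \<theta>\<^sub>P\<^sub>S"

(* The sigma-algebra generated by z 0, ..., z k. The parameters of the algorithm up to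
   time k are functions of these states, so they need not be listed as generators. *)
definition past :: "'w measure \<Rightarrow> 'b measure \<Rightarrow> (nat \<Rightarrow> 'w \<Rightarrow> 'b) \<Rightarrow> nat \<Rightarrow> 'w measure" where
  "past M S z k = sigma (space M) (\<Union>i\<le>k. {z i -` A \<inter> space M | A. A \<in> sets S})"

(* A realisation of the algorithm on a probability space M. The last conjunct says that
   P (\<theta> k) (z k) is the conditional law of z (Suc k) given the past. *)
definition sa_process ::
    "'w measure \<Rightarrow> 'b measure \<Rightarrow> ('a \<Rightarrow> 'b \<Rightarrow> 'b measure) \<Rightarrow> ('a \<Rightarrow> 'b \<Rightarrow> 'a::euclidean_space) \<Rightarrow>
     (nat \<Rightarrow> real) \<Rightarrow> 'a \<Rightarrow> (nat \<Rightarrow> 'w \<Rightarrow> 'a) \<Rightarrow> (nat \<Rightarrow> 'w \<Rightarrow> 'b) \<Rightarrow> bool" where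
  "sa_process M S P G \<gamma> \<theta>\<^sub>0 \<theta> z \<longleftrightarrow>
     prob_space M \<and>
     (\<forall>k. z k \<in> M \<rightarrow>\<^sub>M S) \<and>
     (\<forall>\<omega>\<in>space M. \<theta> 0 \<omega> = \<theta>\<^sub>0) \<and>
     (\<forall>k. \<forall>\<omega>\<in>space M. \<theta> (Suc k) \<omega> = \<theta> k \<omega> - \<gamma> (Suc k) *\<^sub>R G (\<theta> k \<omega>) (z (Suc k) \<omega>)) \<and>
     (\<forall>k. \<forall>A\<in>sets S. AE \<omega> in M.
        real_cond_exp M (past M S z k) (indicator (z (Suc k) -` A \<inter> space M)) \<omega> =
        measure (P (\<theta> k \<omega>) (z k \<omega>)) A)"

end

theory Submission
  imports Defs
begin

text \<open>
  Write \<open>e\<^sub>k = \<theta>\<^sub>k - \<theta>\<^sub>P\<^sub>S\<close>, \<open>a = \<mu> - L \<epsilon>\<close> and \<open>U\<^sub>k(z) = P\<^sub>\<theta> Gh(\<theta>; z)\<close> at \<open>\<theta> = \<theta>\<^sub>k\<close>. By the Poisson equation the noise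
  at step \<open>k\<close> is \<open>Gh(\<theta>\<^sub>k; z\<^sub>k\<^sub>+\<^sub>1) - U\<^sub>k(z\<^sub>k\<^sub>+\<^sub>1)\<close>: a martingale difference plus
  \<open>U\<^sub>k(z\<^sub>k) - U\<^sub>k(z\<^sub>k\<^sub>+\<^sub>1)\<close>, which telescopes up to \<open>O(\<gamma>)\<close>. Hence
  \<open>\<Phi>\<^sub>k = E (|e\<^sub>k|\<^sup>2 - 2 \<gamma>\<^sub>k (e\<^sub>k \<bullet> U\<^sub>k(z\<^sub>k)))\<close> contracts by \<open>1 - \<gamma> a / 2\<close> up to \<open>O(\<gamma>\<^sup>2)\<close>, where the part of the
  error proportional to \<open>|e\<^sub>k|\<^sup>2\<close> is absorbed pointwise by the drift. What remains is constant, so no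
  prior uniform bound on \<open>E |e\<^sub>k|\<^sup>2\<close> is needed. The quadratic terms stay small enough because
  \<open>\<gamma>\<^sup>2 |G|\<^sup>2\<close> is not bounded separately: its cross term with the noise combines with the telescoping
  remainder into \<open>2 \<gamma>\<^sup>2 (G \<bullet> Gh)\<close>.

  Neither \<open>Gh\<close> nor the kernel is assumed jointly measurable in \<open>(\<theta>, z)\<close>. However, \<open>G\<close>, the mean gradient
  and \<open>U\<close> are Lipschitz in \<open>\<theta>\<close>, hence so is \<open>Gh\<close>, and discretising \<open>\<theta>\<close> along a countable dense set
  yields both measurability and the conditional expectation of \<open>Gh(\<theta>\<^sub>k; z\<^sub>k\<^sub>+\<^sub>1)\<close>.
\<close>

section \<open>Conditional expectations with a random parameter\<close>

lemma dense_sequence: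
  obtains d :: "nat \<Rightarrow> 'a::euclidean_space" where "\<And>x e. e > 0 \<Longrightarrow> \<exists>n. dist x (d n) < e"
proof -
  obtain D :: "'a set" where D: "countable D" "\<And>X. open X \<Longrightarrow> X \<noteq> {} \<Longrightarrow> \<exists>d\<in>D. d \<in> X"
    using countable_dense_setE by blast
  have ne: "D \<noteq> {}" using D(2)[of UNIV] by auto
  show ?thesis
  proof
    fix x :: 'a and e :: real assume "e > 0"
    then obtain y where "y \<in> D" "dist x y < e" using D(2)[of "ball x e"] by auto
    then show "\<exists>n. dist x (from_nat_into D n) < e"
      using from_nat_into_surj[OF D(1)] by metis
  qed
qed

text \<open>The least index within reach is a measurable choice, because each comparison
  \<open>dist (T \<omega>) (d n) < e\<close> is a measurable event. It takes countably many values,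
  so the discretised parameter \<open>d (N \<omega>)\<close> can be handled one value at a
  time.\<close>

lemma measurable_nearby_index:
  fixes T :: "'w \<Rightarrow> 'a::euclidean_space" and d :: "nat \<Rightarrow> 'a"
  assumes [measurable]: "T \<in> borel_measurable F"
    and d: "\<And>x. \<exists>n. dist x (d n) < e"
  obtains N where "N \<in> F \<rightarrow>\<^sub>M count_space UNIV" "\<And>\<omega>. dist (T \<omega>) (d (N \<omega>)) < e"
proof
  show "(\<lambda>\<omega>. LEAST n. dist (T \<omega>) (d n) < e) \<in> F \<rightarrow>\<^sub>M count_space UNIV" by measurable
  show "dist (T \<omega>) (d (LEAST n. dist (T \<omega>) (d n) < e)) < e" for \<omega>
    using d by (rule LeastI_ex)
qed

text \<open>For a countably valued parameter the composition is measurable piece by piece;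
  continuity in the parameter carries this over to the pointwise limit.\<close>

lemma borel_measurable_Caratheodory:
  fixes T :: "'w \<Rightarrow> 'a::euclidean_space" and f :: "'a \<Rightarrow> 'b \<Rightarrow> 'c::metric_space"
  assumes T: "T \<in> borel_measurable F" and X: "X \<in> F \<rightarrow>\<^sub>M S"
    and f: "\<And>t. f t \<in> borel_measurable S"
    and cont: "\<And>x. x \<in> space S \<Longrightarrow> continuous_on UNIV (\<lambda>t. f t x)"
  shows "(\<lambda>\<omega>. f (T \<omega>) (X \<omega>)) \<in> borel_measurable F"
proof -
  obtain d :: "nat \<Rightarrow> 'a" where d: "\<And>x e. e > 0 \<Longrightarrow> \<exists>n. dist x (d n) < e"
    using dense_sequence by blast
  have "\<exists>N. N \<in> F \<rightarrow>\<^sub>M count_space UNIV \<and> (\<forall>\<omega>. dist (T \<omega>) (d (N \<omega>)) < 1 / Suc n)" for n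
    by (rule measurable_nearby_index[OF T, of d "1 / Suc n"]) (auto intro!: d)
  then obtain N where N: "\<And>n. N n \<in> F \<rightarrow>\<^sub>M count_space UNIV"
    "\<And>n \<omega>. dist (T \<omega>) (d (N n \<omega>)) < 1 / Suc n" by metis
  show ?thesis
  proof (rule borel_measurable_LIMSEQ_metric)
    show "(\<lambda>\<omega>. f (d (N n \<omega>)) (X \<omega>)) \<in> borel_measurable F" for n
      by (rule measurable_compose_countable[OF _ N(1)]) (rule measurable_compose[OF X f])
    fix \<omega> assume w: "\<omega> \<in> space F"
    have "(\<lambda>n. dist (d (N n \<omega>)) (T \<omega>)) \<longlonglongrightarrow> 0"
      by (rule tendsto_sandwich[OF _ _ tendsto_const LIMSEQ_inverse_real_of_nat])
        (use N(2)[of \<omega>] in \<open>auto simp: dist_commute inverse_eq_divide less_imp_le\<close>)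
    then have lim: "(\<lambda>n. d (N n \<omega>)) \<longlonglongrightarrow> T \<omega>" by (subst tendsto_dist_iff)
    have "X \<omega> \<in> space S" using X w by (rule measurable_space)
    from continuous_on_tendsto_compose[OF cont[OF this] lim]
    show "(\<lambda>n. f (d (N n \<omega>)) (X \<omega>)) \<longlonglongrightarrow> f (T \<omega>) (X \<omega>)" by simp
  qed
qed

lemma eq_if_abs_diff_le_inverse_Suc:
  fixes x y c :: real
  assumes "\<And>n. \<bar>x - y\<bar> \<le> c / Suc n"
  shows "x = y"
proof -
  have "(\<lambda>n. c * inverse (real (Suc n))) \<longlonglongrightarrow> c * 0"
    by (intro tendsto_intros LIMSEQ_inverse_real_of_nat)
  then have "\<bar>x - y\<bar> \<le> c * 0"
    by (rule tendsto_lowerbound) (use assms in \<open>auto simp: divide_inverse\<close>)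
  then show ?thesis by simp
qed

lemma (in finite_measure_subalgebra) AE_real_cond_exp_close:
  assumes [measurable]: "integrable M f" "integrable M g"
    and le: "\<And>x. x \<in> space M \<Longrightarrow> \<bar>f x - g x\<bar> \<le> c"
  shows "AE x in M. \<bar>real_cond_exp M F f x - real_cond_exp M F g x\<bar> \<le> c"
proof -
  have int: "integrable M (\<lambda>x. f x - g x)" using assms(1,2) by simp
  have "AE x in M. real_cond_exp M F (\<lambda>x. f x - g x) x \<le> c"
    by (rule real_cond_exp_le_c[OF int]) (use le in \<open>fastforce\<close>)
  moreover have "AE x in M. real_cond_exp M F (\<lambda>x. f x - g x) x \<ge> - c"
    by (rule real_cond_exp_ge_c[OF int]) (use le in \<open>fastforce\<close>)
  moreover have "AE x in M. real_cond_exp M F (\<lambda>x. f x - g x) x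
      = real_cond_exp M F f x - real_cond_exp M F g x" using assms(1,2) by simp
  ultimately show ?thesis by eventually_elim auto
qed

lemma norm_integral_diff_le:
  fixes f g :: "'b \<Rightarrow> 'c::{banach, second_countable_topology}"
  assumes "prob_space N" "integrable N f" "integrable N g"
    and "\<And>x. x \<in> space N \<Longrightarrow> norm (f x - g x) \<le> c"
  shows "norm ((\<integral>x. f x \<partial>N) - (\<integral>x. g x \<partial>N)) \<le> c"
proof -
  interpret prob_space N by fact
  have "norm ((\<integral>x. f x \<partial>N) - (\<integral>x. g x \<partial>N)) = norm (\<integral>x. f x - g x \<partial>N)"
    using assms by simp
  also have "\<dots> \<le> (\<integral>x. norm (f x - g x) \<partial>N)" by (rule integral_norm_bound)
  also have "\<dots> \<le> (\<integral>x. c \<partial>N)" by (rule integral_mono) (use assms in auto)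
  finally show ?thesis by (simp add: prob_space)
qed

lemma integrable_bounded_prob:
  fixes g :: "'b \<Rightarrow> 'c::{banach, second_countable_topology}"
  assumes "N \<in> space (prob_algebra S)" "g \<in> borel_measurable S" "\<And>x. x \<in> space S \<Longrightarrow> norm (g x) \<le> c"
  shows "integrable N g"
proof -
  have N: "prob_space N" "sets N = sets S" using assms(1) by (auto simp: space_prob_algebra)
  interpret prob_space N by (rule N)
  show ?thesis
    by (rule integrable_const_bound[of _ c])
      (use assms N sets_eq_imp_space_eq[OF N(2)] measurable_cong_sets[OF N(2) refl] in auto)
qed

text \<open>Simple functions approximate a bounded function uniformly, which avoids any limit theorem
  for conditional expectations.\<close>
lemma (in finite_measure_subalgebra) real_cond_exp_kernel:
  assumes X: "X \<in> M \<rightarrow>\<^sub>M S"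
    and \<kappa>: "\<And>\<omega>. \<omega> \<in> space M \<Longrightarrow> \<kappa> \<omega> \<in> space (prob_algebra S)"
    and law: "\<And>A. A \<in> sets S \<Longrightarrow>
      AE \<omega> in M. real_cond_exp M F (indicator (X -` A \<inter> space M)) \<omega> = measure (\<kappa> \<omega>) A"
    and g: "g \<in> borel_measurable S" "\<And>x. x \<in> space S \<Longrightarrow> \<bar>g x\<bar> \<le> (c::real)"
  shows "AE \<omega> in M. real_cond_exp M F (\<lambda>\<omega>. g (X \<omega>)) \<omega> = (\<integral>x. g x \<partial>\<kappa> \<omega>)"
proof -
  note [measurable] = X g(1)
  have gX: "integrable M (\<lambda>\<omega>. g (X \<omega>))"
    by (rule integrable_const_bound[of _ c]) (use g(2) measurable_space[OF X] in auto)
  \<comment> \<open>An error of \<open>1 / Suc n\<close> occurs twice: when \<open>g\<close> is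
    replaced by a step function under the conditional expectation, and again under the
    kernel.\<close>
  have "AE \<omega> in M. \<bar>real_cond_exp M F (\<lambda>\<omega>. g (X \<omega>)) \<omega> - (\<integral>x. g x \<partial>\<kappa> \<omega>)\<bar> \<le> 2 / Suc n" for n
  proof -
    \<comment> \<open>\<open>s\<close> below rounds \<open>g\<close> down to a multiple of
      \<open>1 / Suc n\<close>, and \<open>B j\<close> is the set where the result is
      \<open>j / Suc n\<close>. As \<open>g\<close> is bounded, finitely many levels occur;
      \<open>I\<close> contains them with a margin of one at each end.\<close>
    define B where "B j = {x \<in> space S. \<lfloor>Suc n * g x\<rfloor> = j}" for j :: int
    have [measurable]: "B j \<in> sets S" for j unfolding B_def by measurable
    define I where "I = {- \<lceil>Suc n * c\<rceil> - 1 .. \<lceil>Suc n * c\<rceil> + 1}"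
    define s where "s x = (\<Sum>j\<in>I. (j / Suc n) * indicator (B j) x)" for x
    have s_eq: "s x = \<lfloor>Suc n * g x\<rfloor> / Suc n" if x: "x \<in> space S" for x
    proof -
      have "\<bar>Suc n * g x\<bar> \<le> Suc n * c"
        using g(2)[OF x] by (simp add: abs_mult mult_left_mono del: of_nat_Suc)
      then have "\<lfloor>Suc n * g x\<rfloor> \<in> I" unfolding I_def by (simp del: of_nat_Suc) linarith
      then have "(\<Sum>j\<in>I. (j / Suc n) * indicator (B j) x)
          = (\<Sum>j\<in>I. if j = \<lfloor>Suc n * g x\<rfloor> then j / real (Suc n) else 0)"
        using x by (intro sum.cong) (auto simp: B_def)
      then show ?thesis using \<open>\<lfloor>Suc n * g x\<rfloor> \<in> I\<close>
        by (simp add: s_def I_def sum.delta del: of_nat_Suc)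
    qed
    have close: "\<bar>g x - s x\<bar> \<le> 1 / Suc n" if x: "x \<in> space S" for x
    proof -
      have "\<bar>Suc n * g x - \<lfloor>Suc n * g x\<rfloor>\<bar> \<le> 1" by linarith
      moreover have "\<bar>g x - s x\<bar> = \<bar>Suc n * g x - \<lfloor>Suc n * g x\<rfloor>\<bar> / Suc n"
      proof -
        have "g x - s x = (Suc n * g x - \<lfloor>Suc n * g x\<rfloor>) / Suc n"
          unfolding s_eq[OF x] by (simp add: diff_divide_distrib del: of_nat_Suc)
        then show ?thesis by (simp add: abs_divide del: of_nat_Suc)
      qed
      ultimately show ?thesis by (simp add: divide_right_mono del: of_nat_Suc)
    qed
    have ind: "integrable M (\<lambda>\<omega>. (j / Suc n) * indicator (X -` B j \<inter> space M) \<omega> :: real)" for j :: int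
      by (intro integrable_mult_right) (simp add: integrable_indicator_iff emeasure_eq_measure)
    \<comment> \<open>This is \<open>s (X \<omega>)\<close> written with preimages of the sets
      \<open>B j\<close>, the events to which \<open>law\<close> applies.\<close>
    define s' where "s' \<omega> = (\<Sum>j\<in>I. (j / Suc n) * indicator (X -` B j \<inter> space M) \<omega> :: real)" for \<omega>
    have s'_eq: "s' \<omega> = s (X \<omega>)" if "\<omega> \<in> space M" for \<omega>
      using that unfolding s'_def s_def by (auto simp: indicator_def intro!: sum.cong)
    have s'_int: "integrable M s'"
      unfolding s'_def by (intro Bochner_Integration.integrable_sum ind)
    have "AE \<omega> in M. real_cond_exp M F s' \<omega>
        = (\<Sum>j\<in>I. real_cond_exp M F (\<lambda>\<omega>. (j / Suc n) * indicator (X -` B j \<inter> space M) \<omega>) \<omega>)"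
      unfolding s'_def by (rule real_cond_exp_sum[OF ind])
    moreover have "AE \<omega> in M. \<forall>j\<in>I. real_cond_exp M F (\<lambda>\<omega>. (j / Suc n) * indicator (X -` B j \<inter> space M) \<omega>) \<omega>
        = (j / Suc n) * measure (\<kappa> \<omega>) (B j)"
    proof (rule AE_finite_allI)
      show "finite I" by (simp add: I_def)
      fix j assume "j \<in> I"
      have "AE \<omega> in M. real_cond_exp M F (\<lambda>\<omega>. (j / Suc n) * indicator (X -` B j \<inter> space M) \<omega>) \<omega>
         = (j / Suc n) * real_cond_exp M F (indicator (X -` B j \<inter> space M)) \<omega>"
        by (rule real_cond_exp_cmult) (simp add: integrable_indicator_iff emeasure_eq_measure)
      then show "AE \<omega> in M. real_cond_exp M F (\<lambda>\<omega>. (j / Suc n) * indicator (X -` B j \<inter> space M) \<omega>) \<omega>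
        = (j / Suc n) * measure (\<kappa> \<omega>) (B j)"
        using law[of "B j"] by (auto elim: AE_mp)
    qed
    moreover have "AE \<omega> in M. \<bar>real_cond_exp M F (\<lambda>\<omega>. g (X \<omega>)) \<omega> - real_cond_exp M F s' \<omega>\<bar> \<le> 1 / Suc n"
      by (rule AE_real_cond_exp_close[OF gX s'_int])
        (use close s'_eq measurable_space[OF X] in auto)
    moreover note AE_space
    ultimately show ?thesis
    proof eventually_elim
      fix \<omega> assume w: "\<omega> \<in> space M"
        and *: "real_cond_exp M F s' \<omega>
          = (\<Sum>j\<in>I. real_cond_exp M F (\<lambda>\<omega>. (j / Suc n) * indicator (X -` B j \<inter> space M) \<omega>) \<omega>)"
          "\<forall>j\<in>I. real_cond_exp M F (\<lambda>\<omega>. (j / Suc n) * indicator (X -` B j \<inter> space M) \<omega>) \<omega>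
        = (j / Suc n) * measure (\<kappa> \<omega>) (B j)"
          "\<bar>real_cond_exp M F (\<lambda>\<omega>. g (X \<omega>)) \<omega> - real_cond_exp M F s' \<omega>\<bar> \<le> 1 / Suc n"
      have two: "2 / Suc n = 1 / Suc n + 1 / real (Suc n)" by simp
      have N: "prob_space (\<kappa> \<omega>)" "sets (\<kappa> \<omega>) = sets S" using \<kappa>[OF w] by (auto simp: space_prob_algebra)
      interpret N: prob_space "\<kappa> \<omega>" by (rule N)
      have int: "integrable (\<kappa> \<omega>) (\<lambda>x. (j / Suc n) * indicator (B j) x :: real)" for j :: int
        by (intro integrable_mult_right)
          (use N(2) \<open>\<And>j. B j \<in> sets S\<close> in \<open>simp add: integrable_indicator_iff N.emeasure_eq_measure\<close>)
      have "(\<integral>x. s x \<partial>\<kappa> \<omega>) = (\<Sum>j\<in>I. (j / Suc n) * measure (\<kappa> \<omega>) (B j))"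
        unfolding s_def using int N(2) \<open>\<And>j. B j \<in> sets S\<close>
        by (subst Bochner_Integration.integral_sum) (auto simp: sets.Int_space_eq2)
      then have "(\<integral>x. s x \<partial>\<kappa> \<omega>) = real_cond_exp M F s' \<omega>" using * by simp
      moreover have "\<bar>(\<integral>x. g x \<partial>\<kappa> \<omega>) - (\<integral>x. s x \<partial>\<kappa> \<omega>)\<bar> \<le> 1 / Suc n"
      proof (rule norm_integral_diff_le[where 'c = real, OF N(1), unfolded real_norm_def])
        show "integrable (\<kappa> \<omega>) g" by (rule integrable_bounded_prob[OF \<kappa>[OF w] g(1)]) (use g(2) in auto)
        show "integrable (\<kappa> \<omega>) s" unfolding s_def by (intro Bochner_Integration.integrable_sum int)
      qed (use close sets_eq_imp_space_eq[OF N(2)] in auto)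
      ultimately show "\<bar>real_cond_exp M F (\<lambda>\<omega>. g (X \<omega>)) \<omega> - (\<integral>x. g x \<partial>\<kappa> \<omega>)\<bar> \<le> 2 / Suc n"
        using *(3) two by linarith
    qed
  qed
  then have "AE \<omega> in M. \<forall>n. \<bar>real_cond_exp M F (\<lambda>\<omega>. g (X \<omega>)) \<omega> - (\<integral>x. g x \<partial>\<kappa> \<omega>)\<bar> \<le> 2 / Suc n"
    unfolding AE_all_countable ..
  then show ?thesis
    by eventually_elim (rule eq_if_abs_diff_le_inverse_Suc[of _ _ 2], blast)
qed

text \<open>On an event of \<open>F\<close> where the discretised parameter equals
  \<open>d q\<close>, it behaves like a constant and the fixed-parameter case applies. The Lipschitz
  bound is uniform in \<open>x\<close>, so discretising costs at most \<open>K / Suc n\<close> on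
  either side of the identity.\<close>

lemma (in finite_measure_subalgebra) real_cond_exp_kernel_parameter:
  fixes T :: "'a \<Rightarrow> 'c::euclidean_space" and h :: "'c \<Rightarrow> 'b \<Rightarrow> real"
  assumes X: "X \<in> M \<rightarrow>\<^sub>M S" and T: "T \<in> borel_measurable F"
    and \<kappa>: "\<And>\<omega>. \<omega> \<in> space M \<Longrightarrow> \<kappa> \<omega> \<in> space (prob_algebra S)"
    and law: "\<And>A. A \<in> sets S \<Longrightarrow>
      AE \<omega> in M. real_cond_exp M F (indicator (X -` A \<inter> space M)) \<omega> = measure (\<kappa> \<omega>) A"
    and h: "\<And>t. h t \<in> borel_measurable S" "\<And>t x. x \<in> space S \<Longrightarrow> \<bar>h t x\<bar> \<le> b t"
    and lip: "K \<ge> 0" "\<And>t t' x. x \<in> space S \<Longrightarrow> \<bar>h t x - h t' x\<bar> \<le> K * dist t t'"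
    and int: "integrable M (\<lambda>\<omega>. h (T \<omega>) (X \<omega>))"
  shows "AE \<omega> in M. real_cond_exp M F (\<lambda>\<omega>. h (T \<omega>) (X \<omega>)) \<omega> = (\<integral>x. h (T \<omega>) x \<partial>\<kappa> \<omega>)"
proof -
  obtain d :: "nat \<Rightarrow> 'c" where d: "\<And>x e. e > 0 \<Longrightarrow> \<exists>n. dist x (d n) < e"
    using dense_sequence by blast
  note XS = measurable_space[OF X]
  have hX[measurable]: "(\<lambda>\<omega>. h t (X \<omega>)) \<in> borel_measurable M" for t by (rule measurable_compose[OF X h(1)])
  \<comment> \<open>Countability of the dense sequence yields one null set for all \<open>q\<close>;
    this is why the parameter is discretised first.\<close>
  have fixed: "AE \<omega> in M. \<forall>q. real_cond_exp M F (\<lambda>\<omega>. h (d q) (X \<omega>)) \<omega> = (\<integral>x. h (d q) x \<partial>\<kappa> \<omega>)"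
    unfolding AE_all_countable
    by (intro allI real_cond_exp_kernel[OF X \<kappa> law h(1) h(2)])
  have "AE \<omega> in M. \<bar>real_cond_exp M F (\<lambda>\<omega>. h (T \<omega>) (X \<omega>)) \<omega> - (\<integral>x. h (T \<omega>) x \<partial>\<kappa> \<omega>)\<bar>
      \<le> 2 * K / Suc n" for n
  proof -
    obtain N where N[measurable]: "N \<in> F \<rightarrow>\<^sub>M count_space UNIV"
      and close: "\<And>\<omega>. dist (T \<omega>) (d (N \<omega>)) < 1 / Suc n"
      by (rule measurable_nearby_index[OF T, of d "1 / Suc n"]) (auto intro!: d)
    have NM: "N \<in> M \<rightarrow>\<^sub>M count_space UNIV" by (rule measurable_from_subalg[OF subalg N])
    have lipN: "\<bar>h (T \<omega>) x - h (d (N \<omega>)) x\<bar> \<le> K / Suc n" if "x \<in> space S" for x \<omega>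
      using lip(2)[OF that, of "T \<omega>" "d (N \<omega>)"] mult_left_mono[OF less_imp_le[OF close[of \<omega>]] lip(1)] by simp
    have meas: "(\<lambda>\<omega>. h (d (N \<omega>)) (X \<omega>)) \<in> borel_measurable M"
      by (rule measurable_compose_countable[OF hX NM])
    have intN: "integrable M (\<lambda>\<omega>. h (d (N \<omega>)) (X \<omega>))"
    proof (rule Bochner_Integration.integrable_bound[of _ "\<lambda>\<omega>. \<bar>h (T \<omega>) (X \<omega>)\<bar> + K / Suc n"])
      show "integrable M (\<lambda>\<omega>. \<bar>h (T \<omega>) (X \<omega>)\<bar> + K / real (Suc n))" using int by simp
      show "AE \<omega> in M. norm (h (d (N \<omega>)) (X \<omega>)) \<le> norm (\<bar>h (T \<omega>) (X \<omega>)\<bar> + K / real (Suc n))"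
      proof (rule AE_I2)
        fix \<omega> assume "\<omega> \<in> space M"
        from lipN[OF XS[OF this], of \<omega>]
        show "norm (h (d (N \<omega>)) (X \<omega>)) \<le> norm (\<bar>h (T \<omega>) (X \<omega>)\<bar> + K / real (Suc n))"
          unfolding real_norm_def by linarith
      qed
    qed (rule meas)
    define B where "B q = N -` {q} \<inter> space F" for q
    have B[measurable]: "B q \<in> sets F" for q unfolding B_def by measurable
    have spF: "space F = space M" using subalg by (simp add: subalgebra_def)
    \<comment> \<open>The indicator of \<open>B q\<close> is \<open>F\<close>-measurable and can be
      pulled out. The two products agree everywhere, so the two conditional expectations agree on
      \<open>B q\<close>.\<close>
    have "AE \<omega> in M. indicator (B q) \<omega> * real_cond_exp M F (\<lambda>\<omega>. h (d (N \<omega>)) (X \<omega>)) \<omega>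
      = indicator (B q) \<omega> * real_cond_exp M F (\<lambda>\<omega>. h (d q) (X \<omega>)) \<omega>" for q
    proof -
      have BM[measurable]: "B q \<in> sets M" using B subalg by (auto simp: subalgebra_def)
      have eq: "(\<lambda>\<omega>. indicator (B q) \<omega> * h (d (N \<omega>)) (X \<omega>)) = (\<lambda>\<omega>. indicator (B q) \<omega> * h (d q) (X \<omega>))"
        by (auto simp: indicator_def B_def)
      have 1: "integrable M (\<lambda>\<omega>. indicator (B q) \<omega> * h (d (N \<omega>)) (X \<omega>))"
        using integrable_real_mult_indicator[OF BM intN] by (simp add: mult.commute)
      have "AE \<omega> in M. real_cond_exp M F (\<lambda>\<omega>. indicator (B q) \<omega> * h (d (N \<omega>)) (X \<omega>)) \<omega> =
          indicator (B q) \<omega> * real_cond_exp M F (\<lambda>\<omega>. h (d (N \<omega>)) (X \<omega>)) \<omega>"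
        by (rule real_cond_exp_mult[OF _ meas 1]) measurable
      moreover have "AE \<omega> in M. real_cond_exp M F (\<lambda>\<omega>. indicator (B q) \<omega> * h (d q) (X \<omega>)) \<omega> =
          indicator (B q) \<omega> * real_cond_exp M F (\<lambda>\<omega>. h (d q) (X \<omega>)) \<omega>"
        by (rule real_cond_exp_mult[OF _ hX]) (use 1 eq in \<open>auto\<close>)
      ultimately show ?thesis unfolding eq by eventually_elim metis
    qed
    then have "AE \<omega> in M. \<forall>q. indicator (B q) \<omega> * real_cond_exp M F (\<lambda>\<omega>. h (d (N \<omega>)) (X \<omega>)) \<omega>
      = indicator (B q) \<omega> * real_cond_exp M F (\<lambda>\<omega>. h (d q) (X \<omega>)) \<omega>"
      unfolding AE_all_countable ..
    moreover have "AE \<omega> in M. \<bar>real_cond_exp M F (\<lambda>\<omega>. h (T \<omega>) (X \<omega>)) \<omega>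
         - real_cond_exp M F (\<lambda>\<omega>. h (d (N \<omega>)) (X \<omega>)) \<omega>\<bar> \<le> K / Suc n"
      by (rule AE_real_cond_exp_close[OF int intN]) (use lipN XS in auto)
    moreover note fixed AE_space
    ultimately show ?thesis
    proof eventually_elim
      fix \<omega> assume w: "\<omega> \<in> space M"
        and *: "\<forall>q. indicator (B q) \<omega> * real_cond_exp M F (\<lambda>\<omega>. h (d (N \<omega>)) (X \<omega>)) \<omega>
      = indicator (B q) \<omega> * real_cond_exp M F (\<lambda>\<omega>. h (d q) (X \<omega>)) \<omega>"
          "\<bar>real_cond_exp M F (\<lambda>\<omega>. h (T \<omega>) (X \<omega>)) \<omega>
         - real_cond_exp M F (\<lambda>\<omega>. h (d (N \<omega>)) (X \<omega>)) \<omega>\<bar> \<le> K / Suc n"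
          "\<forall>q. real_cond_exp M F (\<lambda>\<omega>. h (d q) (X \<omega>)) \<omega> = (\<integral>x. h (d q) x \<partial>\<kappa> \<omega>)"
      have two: "2 * K / Suc n = K / Suc n + K / Suc n" by simp
      have N: "prob_space (\<kappa> \<omega>)" "sets (\<kappa> \<omega>) = sets S" using \<kappa>[OF w] by (auto simp: space_prob_algebra)
      have "real_cond_exp M F (\<lambda>\<omega>. h (d (N \<omega>)) (X \<omega>)) \<omega> = (\<integral>x. h (d (N \<omega>)) x \<partial>\<kappa> \<omega>)"
        using spec[OF *(1), of "N \<omega>"] *(3) w spF by (simp add: B_def)
      moreover have "\<bar>(\<integral>x. h (T \<omega>) x \<partial>\<kappa> \<omega>) - (\<integral>x. h (d (N \<omega>)) x \<partial>\<kappa> \<omega>)\<bar> \<le> K / Suc n"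
        by (rule norm_integral_diff_le[where 'c = real, OF N(1), unfolded real_norm_def])
          (use integrable_bounded_prob[OF \<kappa>[OF w] h(1)] h(2) lipN sets_eq_imp_space_eq[OF N(2)] in auto)
      ultimately show "\<bar>real_cond_exp M F (\<lambda>\<omega>. h (T \<omega>) (X \<omega>)) \<omega> - (\<integral>x. h (T \<omega>) x \<partial>\<kappa> \<omega>)\<bar>
          \<le> 2 * K / Suc n"
        using *(2) two by linarith
    qed
  qed
  then have "AE \<omega> in M. \<forall>n. \<bar>real_cond_exp M F (\<lambda>\<omega>. h (T \<omega>) (X \<omega>)) \<omega> - (\<integral>x. h (T \<omega>) x \<partial>\<kappa> \<omega>)\<bar>
      \<le> 2 * K / Suc n"
    unfolding AE_all_countable ..
  then show ?thesis
    by eventually_elim (rule eq_if_abs_diff_le_inverse_Suc[of _ _ "2 * K"], blast)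
qed

text \<open>Coordinatewise, the \<open>F\<close>-measurable factor \<open>w\<close> may be
  integrated against the conditional expectation in place of the variable itself. The kernel
  integral enters as a function \<open>U\<close> with its own measurability hypothesis, since
  \<open>\<kappa>\<close> is only assumed to take values in the probability measures.\<close>

lemma (in finite_measure_subalgebra) integral_inner_kernel_parameter:
  fixes T :: "'a \<Rightarrow> 'c::euclidean_space" and V :: "'c \<Rightarrow> 'b \<Rightarrow> 'd::euclidean_space"
  assumes X: "X \<in> M \<rightarrow>\<^sub>M S" and T: "T \<in> borel_measurable F"
    and \<kappa>: "\<And>\<omega>. \<omega> \<in> space M \<Longrightarrow> \<kappa> \<omega> \<in> space (prob_algebra S)"
    and law: "\<And>A. A \<in> sets S \<Longrightarrow>
      AE \<omega> in M. real_cond_exp M F (indicator (X -` A \<inter> space M)) \<omega> = measure (\<kappa> \<omega>) A"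
    and V: "\<And>t. V t \<in> borel_measurable S" "\<And>t x. x \<in> space S \<Longrightarrow> norm (V t x) \<le> b t"
    and lip: "K \<ge> 0" "\<And>t t' x. x \<in> space S \<Longrightarrow> norm (V t x - V t' x) \<le> K * dist t t'"
    and VX: "\<And>\<omega>. \<omega> \<in> space M \<Longrightarrow> norm (V (T \<omega>) (X \<omega>)) \<le> c"
    and w: "w \<in> borel_measurable F" "\<And>\<omega>. \<omega> \<in> space M \<Longrightarrow> norm (w \<omega>) \<le> c'"
    and U: "U \<in> borel_measurable M" "\<And>\<omega>. \<omega> \<in> space M \<Longrightarrow> U \<omega> = (\<integral>x. V (T \<omega>) x \<partial>\<kappa> \<omega>)"
  shows "(\<integral>\<omega>. w \<omega> \<bullet> V (T \<omega>) (X \<omega>) \<partial>M) = (\<integral>\<omega>. w \<omega> \<bullet> U \<omega> \<partial>M)"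
proof -
  have VTX[measurable]: "(\<lambda>\<omega>. V (T \<omega>) (X \<omega>)) \<in> borel_measurable M"
  proof (rule borel_measurable_Caratheodory[OF measurable_from_subalg[OF subalg T] X V(1)])
    fix x assume "x \<in> space S"
    then have "K-lipschitz_on UNIV (\<lambda>t. V t x)"
      using lip by (intro lipschitz_onI) (auto simp: dist_norm)
    then show "continuous_on UNIV (\<lambda>t. V t x)" by (rule lipschitz_on_continuous_on)
  qed
  have wM[measurable]: "w \<in> borel_measurable M" by (rule measurable_from_subalg[OF subalg w(1)])
  note [measurable] = w(1) U(1)
  have coord: "integrable M (\<lambda>\<omega>. (w \<omega> \<bullet> i) * (V (T \<omega>) (X \<omega>) \<bullet> i))
      \<and> integrable M (\<lambda>\<omega>. (w \<omega> \<bullet> i) * (U \<omega> \<bullet> i))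
      \<and> (\<integral>\<omega>. (w \<omega> \<bullet> i) * (V (T \<omega>) (X \<omega>) \<bullet> i) \<partial>M) = (\<integral>\<omega>. (w \<omega> \<bullet> i) * (U \<omega> \<bullet> i) \<partial>M)"
    if i: "i \<in> Basis" for i
  proof -
    have le: "\<bar>v \<bullet> i\<bar> \<le> norm v" for v :: 'd using i by (rule Basis_le_norm)
    have int: "integrable M (\<lambda>\<omega>. V (T \<omega>) (X \<omega>) \<bullet> i)"
      by (rule integrable_const_bound[of _ c]) (use le order_trans VX in \<open>fastforce\<close>, measurable)
    have int2: "integrable M (\<lambda>\<omega>. (w \<omega> \<bullet> i) * (V (T \<omega>) (X \<omega>) \<bullet> i))"
    proof (rule integrable_const_bound[of _ "c' * c"])
      have "norm ((w \<omega> \<bullet> i) * (V (T \<omega>) (X \<omega>) \<bullet> i)) \<le> c' * c" if "\<omega> \<in> space M" for \<omega>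
        unfolding real_norm_def abs_mult
        using order_trans[OF le w(2)[OF that]] order_trans[OF le VX[OF that]] by (intro mult_mono) auto
      then show "AE \<omega> in M. norm ((w \<omega> \<bullet> i) * (V (T \<omega>) (X \<omega>) \<bullet> i)) \<le> c' * c" by auto
    qed measurable
    have "AE \<omega> in M. real_cond_exp M F (\<lambda>\<omega>. V (T \<omega>) (X \<omega>) \<bullet> i) \<omega> = (\<integral>x. V (T \<omega>) x \<bullet> i \<partial>\<kappa> \<omega>)"
    proof (rule real_cond_exp_kernel_parameter[OF X T \<kappa> law, where K = K and b = b])
      show "\<bar>V t x \<bullet> i\<bar> \<le> b t" if "x \<in> space S" for t x using order_trans[OF le V(2)[OF that]] .
      show "\<bar>V t x \<bullet> i - V t' x \<bullet> i\<bar> \<le> K * dist t t'" if "x \<in> space S" for t t' x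
        using order_trans[OF le lip(2)[OF that]] by (simp add: inner_diff_left)
      show "(\<lambda>x. V t x \<bullet> i) \<in> borel_measurable S" for t using V(1)[of t] by measurable
    qed (use lip int in auto)
    then have ae: "AE \<omega> in M. (w \<omega> \<bullet> i) * real_cond_exp M F (\<lambda>\<omega>. V (T \<omega>) (X \<omega>) \<bullet> i) \<omega> = (w \<omega> \<bullet> i) * (U \<omega> \<bullet> i)"
      using AE_space
    proof eventually_elim
      case (elim \<omega>)
      have "integrable (\<kappa> \<omega>) (V (T \<omega>))" by (rule integrable_bounded_prob[OF \<kappa>[OF elim(2)] V])
      then show ?case using elim U(2) by simp
    qed
    have wi: "(\<lambda>\<omega>. w \<omega> \<bullet> i) \<in> borel_measurable F" by measurable
    have Vi: "(\<lambda>\<omega>. V (T \<omega>) (X \<omega>) \<bullet> i) \<in> borel_measurable M" by measurable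
    note rce = real_cond_exp_intg[OF int2 wi Vi]
    have "integrable M (\<lambda>\<omega>. (w \<omega> \<bullet> i) * (U \<omega> \<bullet> i))"
      by (rule integrable_cong_AE_imp[OF rce(1) _ ae]) measurable
    moreover have "(\<integral>\<omega>. (w \<omega> \<bullet> i) * real_cond_exp M F (\<lambda>\<omega>. V (T \<omega>) (X \<omega>) \<bullet> i) \<omega> \<partial>M)
        = (\<integral>\<omega>. (w \<omega> \<bullet> i) * (U \<omega> \<bullet> i) \<partial>M)"
      by (rule integral_cong_AE[OF _ _ ae]) measurable
    ultimately show ?thesis using rce(2) int2 by simp
  qed
  have "(\<integral>\<omega>. w \<omega> \<bullet> V (T \<omega>) (X \<omega>) \<partial>M) = (\<integral>\<omega>. (\<Sum>i\<in>Basis. (w \<omega> \<bullet> i) * (V (T \<omega>) (X \<omega>) \<bullet> i)) \<partial>M)"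
    by (intro Bochner_Integration.integral_cong refl euclidean_inner)
  also have "\<dots> = (\<integral>\<omega>. (\<Sum>i\<in>Basis. (w \<omega> \<bullet> i) * (U \<omega> \<bullet> i)) \<partial>M)"
    using coord by (simp add: Bochner_Integration.integral_sum)
  also have "\<dots> = (\<integral>\<omega>. w \<omega> \<bullet> U \<omega> \<partial>M)"
    by (intro Bochner_Integration.integral_cong refl euclidean_inner[symmetric])
  finally show ?thesis .
qed

lemma past_subalgebra: "(\<And>k. z k \<in> M \<rightarrow>\<^sub>M S) \<Longrightarrow> subalgebra M (past M S z k)"
proof -
  assume z: "\<And>k. z k \<in> M \<rightarrow>\<^sub>M S"
  let ?A = "\<Union>i\<le>k. {z i -` A \<inter> space M | A. A \<in> sets S}"
  have sub: "?A \<subseteq> Pow (space M)" by auto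
  have "?A \<subseteq> sets M" using measurable_sets[OF z] by auto
  then show ?thesis
    unfolding subalgebra_def past_def sets_measure_of[OF sub] space_measure_of[OF sub]
    by (simp add: sets.sigma_sets_subset)
qed

lemma measurable_past:
  assumes z: "\<And>k. z k \<in> M \<rightarrow>\<^sub>M S" and "i \<le> k"
  shows "z i \<in> past M S z k \<rightarrow>\<^sub>M S"
proof (rule measurableI)
  let ?A = "\<Union>i\<le>k. {z i -` A \<inter> space M | A. A \<in> sets S}"
  have sub: "?A \<subseteq> Pow (space M)" by auto
  have sp: "space (past M S z k) = space M" unfolding past_def by (rule space_measure_of[OF sub])
  show "z i \<omega> \<in> space S" if "\<omega> \<in> space (past M S z k)" for \<omega>
    using that measurable_space[OF z] sp by auto
  show "z i -` A \<inter> space (past M S z k) \<in> sets (past M S z k)" if "A \<in> sets S" for A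
    unfolding sp unfolding past_def sets_measure_of[OF sub]
    using that assms(2) by (intro sigma_sets.Basic) auto
qed

section \<open>Drift towards the stable point\<close>

text \<open>The easy half of Kantorovich duality: under any coupling the difference of the integrals
  is the mean of \<open>f z - f z'\<close>, which the Lipschitz bound controls by the transport
  cost, because the Euclidean norm is at most the l1 norm.\<close>

lemma norm_integral_diff_le_W1:
  fixes Z :: "'b::euclidean_space set" and f :: "'b \<Rightarrow> 'a::euclidean_space"
  assumes S: "S = restrict_space borel Z"
    and N: "N\<^sub>1 \<in> space (prob_algebra S)" "N\<^sub>2 \<in> space (prob_algebra S)"
    and f: "f \<in> borel_measurable S" "\<And>x. x \<in> Z \<Longrightarrow> norm (f x) \<le> b"
    and L: "L > 0" "\<And>x y. x \<in> Z \<Longrightarrow> y \<in> Z \<Longrightarrow> norm (f x - f y) \<le> L * norm (x - y)"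
    and W: "W1 N\<^sub>1 N\<^sub>2 \<le> ennreal c" "c \<ge> 0"
  shows "norm ((\<integral>x. f x \<partial>N\<^sub>1) - (\<integral>x. f x \<partial>N\<^sub>2)) \<le> L * c"
proof -
  let ?n = "norm ((\<integral>x. f x \<partial>N\<^sub>1) - (\<integral>x. f x \<partial>N\<^sub>2))"
  have spS: "space S = Z" by (simp add: S space_restrict_space)
  have sets: "sets N\<^sub>1 = sets S" "sets N\<^sub>2 = sets S" using N by (auto simp: space_prob_algebra)
  \<comment> \<open>Dividing by \<open>L\<close> first turns the claim into a lower bound for the
    cost of every coupling, hence for the infimum.\<close>
  have "ennreal (?n / L) \<le> (\<integral>\<^sup>+ (z, z'). ennreal (l1_norm (z - z')) \<partial>J)"
    if J: "J \<in> couplings N\<^sub>1 N\<^sub>2" for J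
  proof -
    have sJ: "sets J = sets (S \<Otimes>\<^sub>M S)"
      using J sets by (auto simp: couplings_def cong: sets_pair_measure_cong)
    have d: "distr J N\<^sub>1 fst = N\<^sub>1" "distr J N\<^sub>2 snd = N\<^sub>2" using J by (auto simp: couplings_def)
    have spJ: "space J = Z \<times> Z"
      using sets_eq_imp_space_eq[OF sJ] by (simp add: space_pair_measure spS)
    have [measurable]: "fst \<in> J \<rightarrow>\<^sub>M S" "snd \<in> J \<rightarrow>\<^sub>M S"
      by (simp_all add: measurable_cong_sets[OF sJ refl])
    have m1[measurable]: "fst \<in> J \<rightarrow>\<^sub>M N\<^sub>1" "snd \<in> J \<rightarrow>\<^sub>M N\<^sub>2"
      by (simp_all add: measurable_cong_sets[OF refl sets(1)] measurable_cong_sets[OF refl sets(2)])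
    have fm: "f \<in> borel_measurable N\<^sub>1" "f \<in> borel_measurable N\<^sub>2"
      using f(1) by (simp_all add: measurable_cong_sets[OF sets(1) refl] measurable_cong_sets[OF sets(2) refl])
    have int: "integrable N\<^sub>1 f" "integrable N\<^sub>2 f"
      using integrable_bounded_prob[OF N(1) f(1)] integrable_bounded_prob[OF N(2) f(1)] f(2) spS by auto
    have i1: "integrable J (\<lambda>u. f (fst u))" "integrable J (\<lambda>u. f (snd u))"
      using int integrable_distr_eq[OF m1(1) fm(1)] integrable_distr_eq[OF m1(2) fm(2)] d by auto
    have eq: "(\<integral>x. f x \<partial>N\<^sub>1) = (\<integral>u. f (fst u) \<partial>J)" "(\<integral>x. f x \<partial>N\<^sub>2) = (\<integral>u. f (snd u) \<partial>J)"
      using integral_distr[OF m1(1) fm(1)] integral_distr[OF m1(2) fm(2)] d by auto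
    have "S = restrict_space borel Z" by (rule S)
    then have "(\<lambda>x. x) \<in> S \<rightarrow>\<^sub>M borel" by (simp add: measurable_restrict_space1)
    then have bm[measurable]: "fst \<in> borel_measurable J" "snd \<in> borel_measurable J"
      using measurable_compose[of fst J S "\<lambda>x. x"] measurable_compose[of snd J S "\<lambda>x. x"] by auto
    have l1m: "(\<lambda>u. ennreal (l1_norm (fst u - snd u))) \<in> borel_measurable J"
      unfolding l1_norm_def by measurable
    have "ennreal ?n = ennreal (norm (\<integral>u. f (fst u) - f (snd u) \<partial>J))"
      unfolding eq by (simp add: i1)
    also have "\<dots> \<le> (\<integral>\<^sup>+u. norm (f (fst u) - f (snd u)) \<partial>J)"
      by (rule integral_norm_bound_ennreal) (simp add: i1)
    also have "\<dots> \<le> (\<integral>\<^sup>+u. ennreal L * ennreal (l1_norm (fst u - snd u)) \<partial>J)"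
    proof (rule nn_integral_mono)
      fix u assume "u \<in> space J"
      then have "norm (f (fst u) - f (snd u)) \<le> L * norm (fst u - snd u)" using L(2) spJ by auto
      also have "\<dots> \<le> L * l1_norm (fst u - snd u)"
        unfolding l1_norm_def using L(1) by (intro mult_left_mono norm_le_l1) auto
      finally show "ennreal (norm (f (fst u) - f (snd u))) \<le> ennreal L * ennreal (l1_norm (fst u - snd u))"
        using L(1) by (subst ennreal_mult[symmetric]) (auto simp: l1_norm_def intro!: sum_nonneg ennreal_leI)
    qed
    also have "\<dots> = ennreal L * (\<integral>\<^sup>+u. ennreal (l1_norm (fst u - snd u)) \<partial>J)"
      by (rule nn_integral_cmult[OF l1m])
    finally have le: "ennreal ?n \<le> ennreal L * (\<integral>\<^sup>+u. ennreal (l1_norm (fst u - snd u)) \<partial>J)" .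
    have "ennreal (?n / L) \<le> (\<integral>\<^sup>+u. ennreal (l1_norm (fst u - snd u)) \<partial>J)"
    proof (cases "\<integral>\<^sup>+u. ennreal (l1_norm (fst u - snd u)) \<partial>J")
      case (real q)
      then show ?thesis using le L(1)
        by (simp add: ennreal_mult[symmetric] ennreal_le_iff mult.commute pos_divide_le_eq)
    qed simp
    then show ?thesis by (simp add: case_prod_unfold)
  qed
  then have "ennreal (?n / L) \<le> W1 N\<^sub>1 N\<^sub>2" unfolding W1_def by (rule INF_greatest)
  then have "ennreal (?n / L) \<le> ennreal c" using W(1) by (rule order_trans)
  then have "?n / L \<le> c" using W(2) by (simp add: ennreal_le_iff)
  then show ?thesis using L(1) by (simp add: pos_divide_le_eq mult.commute)
qed

text \<open>If \<open>m s\<close> were nonzero, a short step from \<open>s\<close> against it would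
  leave \<open>m\<close> almost unchanged and make the inner product negative. Together with
  convexity this replaces differentiation of the risk under the integral sign.\<close>

lemma gradient_zero_if_minimal:
  fixes m :: "'a::real_inner \<Rightarrow> 'a"
  assumes nonneg: "\<And>t. 0 \<le> m t \<bullet> (t - s)"
    and lip: "\<And>t. norm (m t - m s) \<le> L * norm (t - s)"
  shows "m s = 0"
proof (rule ccontr)
  assume ne: "m s \<noteq> 0"
  have L0: "L \<ge> 0"
  proof (rule ccontr)
    assume "\<not> L \<ge> 0"
    then have "L * norm (s + m s - s) < 0" using ne by (simp add: mult_neg_pos)
    then show False using lip[of "s + m s"] norm_ge_zero[of "m (s + m s) - m s"] by linarith
  qed
  define c where "c = 1 / (L + 1)"
  have c: "c > 0" "L * c < 1" using L0 by (auto simp: c_def field_simps)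
  let ?t = "s - c *\<^sub>R m s"
  have "m ?t \<bullet> m s \<le> 0"
    using nonneg[of ?t] c(1) by (simp add: mult_le_0_iff)
  then have "(norm (m s))\<^sup>2 \<le> (m s - m ?t) \<bullet> m s"
    by (simp add: inner_diff_left power2_norm_eq_inner)
  also have "\<dots> \<le> norm (m s - m ?t) * norm (m s)" by (rule norm_cauchy_schwarz)
  also have "\<dots> \<le> (L * (c * norm (m s))) * norm (m s)"
    by (rule mult_right_mono) (use lip[of ?t] c(1) in \<open>auto simp: norm_minus_commute\<close>)
  also have "\<dots> = (L * c) * (norm (m s))\<^sup>2" by (simp add: power2_eq_square)
  finally have "(1 - L * c) * (norm (m s))\<^sup>2 \<le> 0" by (simp add: algebra_simps)
  then show False using c ne by (simp add: mult_le_0_iff)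
qed

text \<open>Strong convexity contracts along the gradient at the stable distribution; moving the
  distribution from the stable point to the current one costs the factor \<open>\<epsilon>\<close>.\<close>
lemma gradient_step_contraction:
  fixes e m m' :: "'a::real_inner"
  assumes mono: "m' \<bullet> e \<ge> \<mu> * (norm e)\<^sup>2" and m': "norm m' \<le> L * norm e"
    and shift: "norm (m - m') \<le> L * \<epsilon> * norm e"
    and \<gamma>: "0 \<le> \<gamma>" "\<gamma> * L\<^sup>2 \<le> (\<mu> - L * \<epsilon>) / 2" "\<gamma> * \<mu> \<le> 1"
  shows "norm (e - \<gamma> *\<^sub>R m) \<le> (1 - 3 / 4 * ((\<mu> - L * \<epsilon>) * \<gamma>)) * norm e"
proof -
  \<comment> \<open>The tangent bound for the square root of
    \<open>1 - 2 * \<mu> * \<gamma> + \<gamma>\<^sup>2 * L\<^sup>2\<close>; its square exceeds that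
    quantity by a perfect square.\<close>
  define q where "q = 1 - \<mu> * \<gamma> + \<gamma>\<^sup>2 * L\<^sup>2 / 2"
  have q: "q \<ge> 0" using \<gamma> by (simp add: q_def mult.commute)
  have "(norm (e - \<gamma> *\<^sub>R m'))\<^sup>2 = (norm e)\<^sup>2 - 2 * \<gamma> * (m' \<bullet> e) + \<gamma>\<^sup>2 * (norm m')\<^sup>2"
    unfolding power2_norm_eq_inner by (simp add: inner_diff inner_commute algebra_simps power2_eq_square)
  also have "\<dots> \<le> (norm e)\<^sup>2 - 2 * \<gamma> * (\<mu> * (norm e)\<^sup>2) + \<gamma>\<^sup>2 * (L * norm e)\<^sup>2"
    using mono m' \<gamma>(1) by (intro add_mono diff_mono mult_left_mono power_mono) auto
  also have "\<dots> = (1 - 2 * \<mu> * \<gamma> + \<gamma>\<^sup>2 * L\<^sup>2) * (norm e)\<^sup>2"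
    by (simp add: algebra_simps power_mult_distrib)
  also have "\<dots> \<le> q\<^sup>2 * (norm e)\<^sup>2"
  proof (rule mult_right_mono)
    have "q\<^sup>2 = 1 - 2 * \<mu> * \<gamma> + \<gamma>\<^sup>2 * L\<^sup>2 + (\<mu> * \<gamma> - \<gamma>\<^sup>2 * L\<^sup>2 / 2)\<^sup>2"
      unfolding q_def by (simp add: power2_eq_square algebra_simps)
    then show "1 - 2 * \<mu> * \<gamma> + \<gamma>\<^sup>2 * L\<^sup>2 \<le> q\<^sup>2" by simp
  qed simp
  finally have "norm (e - \<gamma> *\<^sub>R m') \<le> q * norm e"
    using q by (simp add: power_mult_distrib[symmetric] power2_le_iff_abs_le)
  moreover have "norm (e - \<gamma> *\<^sub>R m) \<le> norm (e - \<gamma> *\<^sub>R m') + norm (\<gamma> *\<^sub>R (m' - m))"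
    using norm_triangle_ineq[of "e - \<gamma> *\<^sub>R m'" "\<gamma> *\<^sub>R (m' - m)"] by (simp add: algebra_simps)
  moreover have "norm (\<gamma> *\<^sub>R (m' - m)) \<le> \<gamma> * (L * \<epsilon> * norm e)"
    using shift \<gamma>(1) by (simp add: mult_left_mono norm_minus_commute)
  \<comment> \<open>With \<open>a = \<mu> - L * \<epsilon>\<close> the three contributions add up to
    \<open>1 - \<mu> * \<gamma> + a * \<gamma> / 4 + L * \<epsilon> * \<gamma>\<close>, that is
    \<open>1 - 3 / 4 * (a * \<gamma>)\<close>.\<close>
  moreover have "(\<gamma> * (\<gamma> * L\<^sup>2) / 2) * norm e \<le> (\<gamma> * ((\<mu> - L * \<epsilon>) / 2) / 2) * norm e"
    using \<gamma> by (intro mult_right_mono divide_right_mono mult_left_mono) auto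
  ultimately show ?thesis
    by (simp add: q_def algebra_simps power2_eq_square)
qed

section \<open>The Lyapunov recursion\<close>

text \<open>Numerically tight: beyond the target rate \<open>\<gamma> a / 2\<close> the drift leaves \<open>0.71875 \<gamma> a x\<^sup>2\<close>, and the
  quadratic parts of the noise terms use up to \<open>0.7171 \<gamma> a x\<^sup>2\<close> of it.\<close>
lemma one_step_estimate:
  fixes x a \<gamma> \<gamma>' H B R T :: real
  assumes pos: "x \<ge> 0" "a > 0" "\<gamma> > 0" "H \<ge> 0" "B \<ge> 0" "R \<ge> 0"
    and y: "a * \<gamma> \<le> 1 / 2"
    and c1: "\<gamma> * (R * B) + 4 * (\<gamma> * (B * H)) + 6 * (a * (\<gamma> * H)) \<le> a / 3"
    and c2: "4 * (\<gamma> * (R * B)) \<le> a"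
    and \<gamma>': "\<gamma> \<le> \<gamma>'" "\<gamma>' \<le> \<gamma> * (1 + \<gamma> * a / 4)"
    and T: "\<bar>T\<bar> \<le> H * x * (1 + x)"
  shows "((1 - 3 / 4 * (a * \<gamma>)) * x)\<^sup>2 - 2 * \<gamma> * T + 2 * \<gamma>\<^sup>2 * (B * H) * (1 + x)\<^sup>2
      + 2 * \<gamma>\<^sup>2 * (R * B) * (1 + x) * (x + 2 * (\<gamma> * H) * (1 + x))
    \<le> (1 - \<gamma> * a / 2) * (x\<^sup>2 - 2 * \<gamma>' * T) + \<gamma>\<^sup>2 * (8 * (B * H) + 2 * (R * B) + a * H / 2)"
proof -
  define p r g where "p = \<gamma> * (B * H)" and "r = \<gamma> * (R * B)" and "g = \<gamma> * H"
  have nn: "p \<ge> 0" "r \<ge> 0" "g \<ge> 0" using pos by (auto simp: p_def r_def g_def)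
  have c: "r + 4 * p + 6 * (a * g) \<le> a / 3" "4 * r \<le> a" using c1 c2 by (auto simp: p_def r_def g_def)
  have "6 * (a * g) \<le> a / 3" using c nn by linarith
  then have g18: "g \<le> 1 / 18" using pos(2) by (simp add: field_simps)
  have rg: "r * g \<le> a / 4 * g" using c(2) nn by (intro mult_right_mono) auto
  have rg': "r * g \<le> r / 18" using mult_left_mono[OF g18 nn(2)] by simp
  \<comment> \<open>The weight is dictated by the constant term: \<open>2 * p * 4\<close> is exactly
    the \<open>8 * p\<close> available on the right.\<close>
  have w2: "(1 + x)\<^sup>2 \<le> 4 + 4 / 3 * x\<^sup>2"
    using zero_le_power2[of "x - 3"] by (simp add: power2_eq_square algebra_simps)
  have w2': "(1 + x)\<^sup>2 \<le> 2 + 2 * x\<^sup>2"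
    using zero_le_power2[of "x - 1"] by (simp add: power2_eq_square algebra_simps)
  \<comment> \<open>Young's inequality with weight 1.55, whose reciprocal is below 0.646. The weight
    is chosen so that the constant terms in \<open>r\<close>, namely 1.55 and 8/18 from
    \<open>r * g\<close>, stay below the available 2.\<close>
  have x1: "2 * x \<le> 155 / 100 + 646 / 1000 * x\<^sup>2"
  proof -
    have "(x - 155 / 100)\<^sup>2 = x\<^sup>2 - 310 / 100 * x + 24025 / 10000"
      by (simp add: power2_eq_square algebra_simps)
    then show ?thesis using zero_le_power2[of "x - 155 / 100"] zero_le_power2[of x] by linarith
  qed
  have x2: "x * (1 + x) \<le> 1 / 2 + 3 / 2 * x\<^sup>2"
    using zero_le_power2[of "x - 1"] by (simp add: power2_eq_square algebra_simps)
  have i1: "2 * p * (1 + x)\<^sup>2 \<le> 8 * p + 8 / 3 * (p * x\<^sup>2)"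
    using mult_left_mono[OF w2 nn(1)] by (simp add: algebra_simps)
  have i2: "r * (2 * x) \<le> 155 / 100 * r + 646 / 1000 * (r * x\<^sup>2)"
    using mult_left_mono[OF x1 nn(2)] by (simp add: algebra_simps)
  have rg0: "r * g \<ge> 0" using nn by simp
  have i3: "(r * g) * (1 + x)\<^sup>2 \<le> 2 * (r * g) + 2 * ((r * g) * x\<^sup>2)"
    using mult_left_mono[OF w2' rg0] by (simp add: algebra_simps)
  have i4: "(r * g) * x\<^sup>2 \<le> a / 4 * g * x\<^sup>2" by (rule mult_right_mono[OF rg]) simp
  have i5: "a * g * (x * (1 + x)) \<le> a * g * (1 / 2 + 3 / 2 * x\<^sup>2)"
    using x2 pos nn by (intro mult_left_mono) auto
  have i6: "(r + 4 * p + 6 * (a * g)) * x\<^sup>2 \<le> a / 3 * x\<^sup>2" "4 * r * x\<^sup>2 \<le> a * x\<^sup>2"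
    using c by (intro mult_right_mono; simp)+
  \<comment> \<open>Since \<open>a * \<gamma>\<close> is at most 1/2, the square term 9/16 returns
    at most 9/32 of the linear 3/2, which leaves 1.21875.\<close>
  have sq: "(1 - 3 / 4 * (a * \<gamma>))\<^sup>2 \<le> 1 - 121875 / 100000 * (a * \<gamma>)"
  proof -
    have "(a * \<gamma>)\<^sup>2 \<le> 1 / 2 * (a * \<gamma>)"
      unfolding power2_eq_square using y pos by (intro mult_right_mono) auto
    then show ?thesis by (simp add: power2_eq_square algebra_simps)
  qed
  have i0: "((1 - 3 / 4 * (a * \<gamma>)) * x)\<^sup>2 \<le> x\<^sup>2 - 121875 / 100000 * (\<gamma> * (a * x\<^sup>2))"
    using mult_right_mono[OF sq, of "x\<^sup>2"] unfolding power_mult_distrib by (simp add: algebra_simps)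
  have Tterm: "- 2 * \<gamma> * T \<le> - (1 - \<gamma> * a / 2) * (2 * \<gamma>' * T) + \<gamma> * (a * g * (x * (1 + x)))"
  proof -
    \<comment> \<open>The mismatch between the contracted old weight and the new weight of the
      correction \<open>T\<close>. The two bounds on \<open>\<gamma>'\<close> make it of order
      \<open>\<gamma>\<^sup>2\<close>.\<close>
    let ?c = "(1 - \<gamma> * a / 2) * \<gamma>' - \<gamma>"
    have half: "0 \<le> 1 - \<gamma> * a / 2" using y by (simp add: mult.commute)
    have "(1 - \<gamma> * a / 2) * \<gamma> \<le> (1 - \<gamma> * a / 2) * \<gamma>'" by (rule mult_left_mono[OF \<gamma>'(1) half])
    then have lo: "- (a * \<gamma>\<^sup>2 / 2) \<le> ?c" by (simp add: algebra_simps power2_eq_square)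
    have "(1 - \<gamma> * a / 2) * \<gamma>' \<le> (1 - \<gamma> * a / 2) * (\<gamma> * (1 + \<gamma> * a / 4))"
      by (rule mult_left_mono[OF \<gamma>'(2) half])
    also have "\<dots> = \<gamma> - a * \<gamma>\<^sup>2 / 4 - \<gamma> * (\<gamma> * a)\<^sup>2 / 8" by (simp add: field_simps power2_eq_square)
    also have "\<dots> \<le> \<gamma>"
    proof -
      have "0 \<le> a * \<gamma>\<^sup>2" "0 \<le> \<gamma> * (\<gamma> * a)\<^sup>2" using pos by auto
      then show ?thesis by linarith
    qed
    finally have hi: "?c \<le> a * \<gamma>\<^sup>2 / 2" using pos by (smt (verit) divide_nonneg_nonneg mult_nonneg_nonneg zero_le_power2)
    have "2 * (?c * T) \<le> 2 * (a * \<gamma>\<^sup>2 / 2 * (H * x * (1 + x)))"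
    proof -
      have abs_c: "\<bar>?c\<bar> \<le> a * \<gamma>\<^sup>2 / 2" using lo hi by linarith
      have "?c * T \<le> \<bar>?c\<bar> * \<bar>T\<bar>" by (metis abs_ge_self abs_mult)
      also have "\<dots> \<le> (a * \<gamma>\<^sup>2 / 2) * (H * x * (1 + x))"
        by (rule mult_mono[OF abs_c T]) (use pos in auto)
      finally show ?thesis by simp
    qed
    then show ?thesis by (simp add: g_def algebra_simps power2_eq_square)
  qed
  \<comment> \<open>The coefficients of \<open>x\<^sup>2\<close> on the left are at most
    \<open>8/3 * p + 2.646 * r + 3.5 * a * g\<close>. Two thirds of the first bound in
    \<open>i6\<close> pay for \<open>p\<close>, \<open>g\<close> and part of \<open>r\<close>; the
    rest of \<open>r\<close>, below 1.98, is paid by the second. The total is under 2/9 + 0.495,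
    hence below 0.71875.\<close>
  have main: "2 * p * (1 + x)\<^sup>2 + 2 * r * (1 + x) * (x + 2 * g * (1 + x)) + a * g * (x * (1 + x))
    \<le> 71875 / 100000 * (a * x\<^sup>2) + (8 * p + 2 * r + a * g / 2)"
  proof -
    have e1: "2 * r * (1 + x) * (x + 2 * g * (1 + x)) = r * (2 * x) + 2 * (r * x\<^sup>2) + 4 * ((r * g) * (1 + x)\<^sup>2)"
      by (simp add: algebra_simps power2_eq_square)
    have nn2: "0 \<le> a * g * x\<^sup>2" "0 \<le> a * x\<^sup>2" "0 \<le> p * x\<^sup>2" "0 \<le> r * x\<^sup>2" using nn pos by auto
    have "a * g * (x * (1 + x)) \<le> 1 / 2 * (a * g) + 3 / 2 * (a * g * x\<^sup>2)"
      using i5 by (simp add: algebra_simps)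
    moreover have "r * x\<^sup>2 + 4 * (p * x\<^sup>2) + 6 * (a * g * x\<^sup>2) \<le> 1 / 3 * (a * x\<^sup>2)" "4 * (r * x\<^sup>2) \<le> a * x\<^sup>2"
      using i6 by (simp_all add: algebra_simps)
    moreover have "(r * g) * x\<^sup>2 \<le> 1 / 4 * (a * g * x\<^sup>2)" using i4 by simp
    ultimately show ?thesis unfolding e1 using i1 i2 i3 rg' nn nn2 by linarith
  qed
  have "\<gamma> * (2 * p * (1 + x)\<^sup>2 + 2 * r * (1 + x) * (x + 2 * g * (1 + x)) + a * g * (x * (1 + x)))
    \<le> \<gamma> * (71875 / 100000 * (a * x\<^sup>2) + (8 * p + 2 * r + a * g / 2))"
    by (rule mult_left_mono[OF main]) (use pos in simp)
  moreover have "2 * \<gamma>\<^sup>2 * (B * H) * (1 + x)\<^sup>2 = \<gamma> * (2 * p * (1 + x)\<^sup>2)"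
    "2 * \<gamma>\<^sup>2 * (R * B) * (1 + x) * (x + 2 * (\<gamma> * H) * (1 + x)) = \<gamma> * (2 * r * (1 + x) * (x + 2 * g * (1 + x)))"
    by (simp_all add: p_def r_def g_def power2_eq_square)
  moreover have "\<gamma>\<^sup>2 * (8 * (B * H) + 2 * (R * B) + a * H / 2) = \<gamma> * (8 * p + 2 * r + a * g / 2)"
    unfolding p_def r_def g_def power2_eq_square
    by (simp only: distrib_left times_divide_eq_right mult_ac)
  moreover have "(1 - \<gamma> * a / 2) * (x\<^sup>2 - 2 * \<gamma>' * T)
      = x\<^sup>2 - 1 / 2 * (\<gamma> * (a * x\<^sup>2)) - (1 - \<gamma> * a / 2) * (2 * \<gamma>' * T)"
    by (simp add: algebra_simps)
  ultimately show ?thesis using i0 Tterm by (simp only: distrib_left)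
qed

text \<open>A pathwise inequality for one step. \<open>V\<close> is the Poisson solution at the new
  state; \<open>U\<^sub>0\<close>, \<open>U\<^sub>1\<close>, \<open>U\<^sub>2\<close> are its kernel
  averages at old parameter and old state, old parameter and new state, new parameter and new state.
  The one term left unestimated, with \<open>V - U\<^sub>0\<close>, is the martingale
  difference.\<close>

lemma lyapunov_step:
  fixes e G m V U\<^sub>0 U\<^sub>1 U\<^sub>2 :: "'a::real_inner"
  assumes poisson: "G - m = V - U\<^sub>1"
    and drift: "norm (e - \<gamma> *\<^sub>R m) \<le> (1 - 3 / 4 * (a * \<gamma>)) * norm e"
    and G: "norm G \<le> B * (1 + norm e)"
    and V: "norm V \<le> H * (1 + norm e)" "norm U\<^sub>0 \<le> H * (1 + norm e)" "norm U\<^sub>1 \<le> H * (1 + norm e)"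
    and U: "norm (U\<^sub>1 - U\<^sub>2) \<le> R * norm (\<gamma> *\<^sub>R G)"
    and pos: "a > 0" "\<gamma> > 0" "H \<ge> 0" "B \<ge> 0" "R \<ge> 0"
    and y: "a * \<gamma> \<le> 1 / 2"
    and c1: "\<gamma> * (R * B) + 4 * (\<gamma> * (B * H)) + 6 * (a * (\<gamma> * H)) \<le> a / 3"
    and c2: "4 * (\<gamma> * (R * B)) \<le> a"
    and \<gamma>': "\<gamma> \<le> \<gamma>'" "\<gamma>' \<le> \<gamma> * (1 + \<gamma> * a / 4)"
  shows "(norm (e - \<gamma> *\<^sub>R G))\<^sup>2 - 2 * \<gamma> * ((e - \<gamma> *\<^sub>R G) \<bullet> U\<^sub>2)
    \<le> (1 - \<gamma> * a / 2) * ((norm e)\<^sup>2 - 2 * \<gamma>' * (e \<bullet> U\<^sub>0)) - 2 * \<gamma> * (e \<bullet> (V - U\<^sub>0))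
      + \<gamma>\<^sup>2 * (8 * (B * H) + 2 * (R * B) + a * H / 2)"
proof -
  define x where "x = norm e"
  let ?e = "e - \<gamma> *\<^sub>R G"
  have x: "x \<ge> 0" by (simp add: x_def)
  have V_eq: "V = G - m + U\<^sub>1" using poisson by (simp add: algebra_simps)
  have expand: "(norm ?e)\<^sup>2 - 2 * \<gamma> * (?e \<bullet> U\<^sub>2) = (norm (e - \<gamma> *\<^sub>R m))\<^sup>2 - \<gamma>\<^sup>2 * (norm (G - m))\<^sup>2
    - 2 * \<gamma> * (e \<bullet> (V - U\<^sub>0)) - 2 * \<gamma> * (e \<bullet> U\<^sub>0) + 2 * \<gamma>\<^sup>2 * (G \<bullet> V) + 2 * \<gamma> * (?e \<bullet> (U\<^sub>1 - U\<^sub>2))"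
    unfolding V_eq power2_norm_eq_inner
    by (simp add: inner_diff inner_add inner_commute algebra_simps power2_eq_square)
  have drift2: "(norm (e - \<gamma> *\<^sub>R m))\<^sup>2 \<le> ((1 - 3 / 4 * (a * \<gamma>)) * x)\<^sup>2"
    using drift by (intro power_mono) (auto simp: x_def)
  have GV: "G \<bullet> V \<le> (B * H) * (1 + x)\<^sup>2"
  proof -
    have "G \<bullet> V \<le> norm G * norm V" by (rule norm_cauchy_schwarz)
    also have "\<dots> \<le> (B * (1 + x)) * (H * (1 + x))"
      using G V(1) pos x by (intro mult_mono) (auto simp: x_def)
    finally show ?thesis by (simp add: power2_eq_square algebra_simps)
  qed
  \<comment> \<open>Going through the drift step bounds the increment by
    \<open>\<gamma> * H\<close>, which \<open>c1\<close> keeps below 1/18, rather than by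
    \<open>\<gamma> * B\<close>.\<close>
  have e: "norm ?e \<le> x + 2 * (\<gamma> * H) * (1 + x)"
  proof -
    have "?e = (e - \<gamma> *\<^sub>R m) - \<gamma> *\<^sub>R (V - U\<^sub>1)" unfolding poisson[symmetric] by (simp add: algebra_simps)
    then have "norm ?e \<le> norm (e - \<gamma> *\<^sub>R m) + norm (\<gamma> *\<^sub>R (V - U\<^sub>1))"
      by (metis norm_triangle_ineq4)
    moreover have "norm (e - \<gamma> *\<^sub>R m) \<le> x"
    proof -
      have "(1 - 3 / 4 * (a * \<gamma>)) * x \<le> 1 * x" using pos x by (intro mult_right_mono) auto
      then show ?thesis using drift by (simp add: x_def)
    qed
    moreover have "norm (\<gamma> *\<^sub>R (V - U\<^sub>1)) \<le> \<gamma> * (H * (1 + x) + H * (1 + x))"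
      using norm_triangle_ineq4[of V "U\<^sub>1"] V(1,3) pos(2) by (simp add: x_def)
    ultimately show ?thesis by (simp add: algebra_simps)
  qed
  have eU: "\<gamma> * (?e \<bullet> (U\<^sub>1 - U\<^sub>2)) \<le> \<gamma> * ((x + 2 * (\<gamma> * H) * (1 + x)) * (R * (\<gamma> * (B * (1 + x)))))"
  proof (rule mult_left_mono)
    have "?e \<bullet> (U\<^sub>1 - U\<^sub>2) \<le> norm ?e * norm (U\<^sub>1 - U\<^sub>2)" by (rule norm_cauchy_schwarz)
    also have "\<dots> \<le> (x + 2 * (\<gamma> * H) * (1 + x)) * (R * (\<gamma> * (B * (1 + x))))"
    proof (rule mult_mono[OF e])
      have "R * norm (\<gamma> *\<^sub>R G) \<le> R * (\<gamma> * (B * (1 + x)))"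
        using G pos by (auto simp: x_def intro!: mult_left_mono)
      then show "norm (U\<^sub>1 - U\<^sub>2) \<le> R * (\<gamma> * (B * (1 + x)))" using U by linarith
    qed (use pos x in auto)
    finally show "?e \<bullet> (U\<^sub>1 - U\<^sub>2) \<le> (x + 2 * (\<gamma> * H) * (1 + x)) * (R * (\<gamma> * (B * (1 + x))))" .
  qed (use pos in simp)
  have T: "\<bar>e \<bullet> U\<^sub>0\<bar> \<le> H * x * (1 + x)"
  proof -
    have "\<bar>e \<bullet> U\<^sub>0\<bar> \<le> norm e * norm U\<^sub>0" by (rule Cauchy_Schwarz_ineq2)
    also have "\<dots> \<le> x * (H * (1 + x))" using V(2) by (auto simp: x_def intro!: mult_left_mono)
    finally show ?thesis by (simp add: algebra_simps)
  qed
  have "2 * \<gamma> * (?e \<bullet> (U\<^sub>1 - U\<^sub>2)) \<le> 2 * \<gamma>\<^sup>2 * (R * B) * (1 + x) * (x + 2 * (\<gamma> * H) * (1 + x))"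
    using eU by (simp add: power2_eq_square algebra_simps)
  moreover have "2 * \<gamma>\<^sup>2 * (G \<bullet> V) \<le> 2 * \<gamma>\<^sup>2 * (B * H) * (1 + x)\<^sup>2"
    using mult_left_mono[OF GV, of "2 * \<gamma>\<^sup>2"] by (simp add: mult.assoc)
  moreover have "0 \<le> \<gamma>\<^sup>2 * (norm (G - m))\<^sup>2" by simp
  moreover note one_step_estimate[OF x pos y c1 c2 \<gamma>' T]
  ultimately show ?thesis unfolding expand x_def[symmetric] using drift2 by linarith
qed

text \<open>The ratio condition gives that the contracted previous step size is at most
  \<open>\<gamma> - a * \<gamma>\<^sup>2 / 4\<close>. Multiplied by \<open>4 / a * K\<close>, the
  deficit is exactly the new error \<open>\<gamma>\<^sup>2 * K\<close>, so the induction
  closes.\<close>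

lemma contraction_recursion:
  fixes \<Phi> \<gamma> :: "nat \<Rightarrow> real"
  assumes step: "\<And>k. \<Phi> (Suc k) \<le> (1 - \<gamma> (Suc k) * a / 2) * \<Phi> k + (\<gamma> (Suc k))\<^sup>2 * K"
    and a: "a > 0" "K \<ge> 0" and \<gamma>: "\<And>k. \<gamma> k > 0" "\<And>k. a * \<gamma> (Suc k) \<le> 1 / 2"
    and ratio: "\<And>k. \<gamma> (Suc k) \<le> \<gamma> (Suc (Suc k)) * (1 + \<gamma> (Suc (Suc k)) * a / 4)"
  shows "\<Phi> (Suc k) \<le> (\<Prod>i=1..Suc k. 1 - \<gamma> i * a / 2) * \<Phi> 0 + 4 / a * K * \<gamma> (Suc k)"
proof (induction k)
  case 0
  have "\<gamma> 1 * \<gamma> 1 \<le> 4 / a * \<gamma> 1"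
  proof (rule mult_right_mono)
    show "\<gamma> 1 \<le> 4 / a" using \<gamma>(2)[of 0] a by (simp add: field_simps)
  qed (use \<gamma>(1)[of 1] in simp)
  then have "(\<gamma> 1 * \<gamma> 1) * K \<le> (4 / a * \<gamma> 1) * K" by (rule mult_right_mono[OF _ a(2)])
  then show ?case using step[of 0] by (simp add: power2_eq_square algebra_simps)
next
  case (Suc k)
  let ?g = "\<gamma> (Suc (Suc k))"
  have half: "0 \<le> 1 - ?g * a / 2" using \<gamma>(2)[of "Suc k"] by (simp add: mult.commute)
  have prodS: "(\<Prod>i=1..Suc (Suc k). 1 - \<gamma> i * a / 2) = (\<Prod>i=1..Suc k. 1 - \<gamma> i * a / 2) * (1 - ?g * a / 2)"
    by simp
  have "\<Phi> (Suc (Suc k)) \<le> (1 - ?g * a / 2) * \<Phi> (Suc k) + ?g\<^sup>2 * K" by (rule step)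
  also have "\<dots> \<le> (1 - ?g * a / 2) * ((\<Prod>i=1..Suc k. 1 - \<gamma> i * a / 2) * \<Phi> 0 + 4 / a * K * \<gamma> (Suc k)) + ?g\<^sup>2 * K"
    using mult_left_mono[OF Suc half] by simp
  also have "\<dots> = (\<Prod>i=1..Suc (Suc k). 1 - \<gamma> i * a / 2) * \<Phi> 0
      + (4 / a * K) * ((1 - ?g * a / 2) * \<gamma> (Suc k)) + ?g\<^sup>2 * K"
    unfolding prodS by (simp only: distrib_left mult_ac)
  finally have "\<Phi> (Suc (Suc k)) \<le> (\<Prod>i=1..Suc (Suc k). 1 - \<gamma> i * a / 2) * \<Phi> 0
      + (4 / a * K) * ((1 - ?g * a / 2) * \<gamma> (Suc k)) + ?g\<^sup>2 * K" .
  moreover have "(4 / a * K) * ((1 - ?g * a / 2) * \<gamma> (Suc k)) + ?g\<^sup>2 * K \<le> 4 / a * K * ?g"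
  proof -
    have "(1 - ?g * a / 2) * \<gamma> (Suc k) \<le> (1 - ?g * a / 2) * (?g * (1 + ?g * a / 4))"
      by (rule mult_left_mono[OF ratio half])
    also have "\<dots> = ?g - a * ?g\<^sup>2 / 4 - ?g * (?g * a)\<^sup>2 / 8" by (simp add: field_simps power2_eq_square)
    also have "\<dots> \<le> ?g - a * ?g\<^sup>2 / 4" using \<gamma>(1)[of "Suc (Suc k)"] by simp
    finally have "(4 / a * K) * ((1 - ?g * a / 2) * \<gamma> (Suc k)) \<le> (4 / a * K) * (?g - a * ?g\<^sup>2 / 4)"
      using a by (intro mult_left_mono) auto
    also have "\<dots> = 4 / a * K * ?g - ?g\<^sup>2 * K" using a by (simp add: right_diff_distrib)
    finally show ?thesis by simp
  qed
  ultimately show ?case by linarith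
qed

text \<open>By the ratio condition and \<open>(1 - u / 2) * (1 + u / 4) \<le> 1\<close>, the step
  sizes decay no faster than the contraction. Hence the initial Poisson correction, of size
  \<open>\<gamma> 1\<close>, ends up as a multiple of the current step size.\<close>

lemma prod_contraction_le:
  fixes \<gamma> :: "nat \<Rightarrow> real"
  assumes a: "a > 0" and \<gamma>: "\<And>k. \<gamma> k > 0" "\<And>k. a * \<gamma> (Suc k) \<le> 1 / 2"
    and ratio: "\<And>k. \<gamma> (Suc k) \<le> \<gamma> (Suc (Suc k)) * (1 + \<gamma> (Suc (Suc k)) * a / 4)"
  shows "\<gamma> 1 * (\<Prod>i=1..Suc k. 1 - \<gamma> i * a / 2) \<le> \<gamma> (Suc k)"
proof (induction k)
  case 0
  have "\<gamma> 1 * (1 - \<gamma> 1 * a / 2) \<le> \<gamma> 1 * 1" using \<gamma>(1)[of 1] a by (intro mult_left_mono) auto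
  then show ?case by simp
next
  case (Suc k)
  let ?g = "\<gamma> (Suc (Suc k))"
  have half: "0 \<le> 1 - ?g * a / 2" using \<gamma>(2)[of "Suc k"] by (simp add: mult.commute)
  have "\<gamma> 1 * (\<Prod>i=1..Suc (Suc k). 1 - \<gamma> i * a / 2)
      = (1 - ?g * a / 2) * (\<gamma> 1 * (\<Prod>i=1..Suc k. 1 - \<gamma> i * a / 2))" by simp
  also have "\<dots> \<le> (1 - ?g * a / 2) * (?g * (1 + ?g * a / 4))"
    using mult_left_mono[OF order_trans[OF Suc ratio] half] .
  also have "\<dots> = ?g - a * ?g\<^sup>2 / 4 - ?g * (?g * a)\<^sup>2 / 8" by (simp add: field_simps power2_eq_square)
  also have "\<dots> \<le> ?g"
  proof -
    have "0 \<le> a * ?g\<^sup>2" "0 \<le> ?g * (?g * a)\<^sup>2" using \<gamma>(1)[of "Suc (Suc k)"] a by auto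
    then show ?thesis by linarith
  qed
  finally show ?case .
qed

text \<open>The Poisson correction in the Lyapunov function is itself bounded through \<open>h\<close>; the crude
  bound \<open>h \<le> 8/3 + 7/5 h\<^sub>0\<close> makes it a multiple of the step size.\<close>
lemma final_estimate:
  fixes h h\<^sub>0 P a \<gamma> \<gamma>\<^sub>1 H B R T T\<^sub>0 s \<sigma> \<Delta> :: real
  assumes pos: "a > 0" "\<gamma> > 0" "\<gamma>\<^sub>1 > 0" "H > 0" "B \<ge> 0" "R \<ge> 0" "h\<^sub>0 \<ge> 0" "0 \<le> P" "P \<le> 1"
    and s: "s \<ge> 1"
    and h: "h - 2 * \<gamma> * T \<le> P * (h\<^sub>0 - 2 * \<gamma>\<^sub>1 * T\<^sub>0)
      + 4 / a * (8 * (B * H) + 2 * (R * B) + a * H / 2) * \<gamma>"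
    and T: "\<bar>T\<bar> \<le> H * (1 / 2 + 3 / 2 * h)" "\<bar>T\<^sub>0\<bar> \<le> H * (1 / 2 + 3 / 2 * h\<^sub>0)"
    and P: "\<gamma>\<^sub>1 * P \<le> \<gamma>"
    and c1: "\<gamma> * (R * B) + 4 * (\<gamma> * (B * H)) + 6 * (a * (\<gamma> * H)) \<le> a / 3"
    and C1: "C\<^sub>1 = s * R * B + 4 * s * B * H + (1 + a) * s * H"
    and C3: "C\<^sub>3 \<ge> 0"
    and \<Delta>: "\<Delta> \<ge> 3 * h\<^sub>0"
  shows "h \<le> P * h\<^sub>0 + (3 * H * \<Delta> + 4 * s / a *
            (2 * (2 * \<sigma>\<^sup>2 + C\<^sub>1) + a * H + (C\<^sub>3 + 3 * a * H) * \<Delta>)) * \<gamma>"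
proof -
  let ?K = "8 * (B * H) + 2 * (R * B) + a * H / 2"
  define g where "g = \<gamma> * H"
  have g: "g > 0" using pos by (simp add: g_def)
  have nn: "0 \<le> \<gamma> * (R * B)" "0 \<le> \<gamma> * (B * H)" using pos by auto
  have "6 * (a * g) \<le> a / 3" using c1 nn unfolding g_def by linarith
  then have g18: "g \<le> 1 / 18" using pos(1) by (simp add: field_simps)
  have T1: "2 * \<gamma> * T \<le> g + 3 * (g * h)"
  proof -
    have "\<gamma> * T \<le> \<gamma> * (H * (1 / 2 + 3 / 2 * h))"
      using T(1) pos by (intro mult_left_mono) auto
    then show ?thesis by (simp add: g_def algebra_simps)
  qed
  have T2: "- P * (2 * \<gamma>\<^sub>1 * T\<^sub>0) \<le> g + 3 * (g * h\<^sub>0)"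
  proof -
    have "(\<gamma>\<^sub>1 * P) * - T\<^sub>0 \<le> (\<gamma>\<^sub>1 * P) * (H * (1 / 2 + 3 / 2 * h\<^sub>0))"
      using T(2) pos by (intro mult_left_mono) auto
    also have "\<dots> \<le> \<gamma> * (H * (1 / 2 + 3 / 2 * h\<^sub>0))"
      using P pos by (intro mult_right_mono) auto
    finally show ?thesis by (simp add: g_def algebra_simps)
  qed
  have base: "h \<le> P * h\<^sub>0 + (2 * g + 3 * (g * h\<^sub>0) + 3 * (g * h)) + 4 / a * ?K * \<gamma>"
    using h T1 T2 by (simp add: right_diff_distrib)
  \<comment> \<open>\<open>?K * \<gamma>\<close> is twice the left side of \<open>c1\<close> less
    \<open>23/2 * (a * g)\<close>; the resulting \<open>- 46 * g\<close> leaves room for the other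
    terms in \<open>g\<close>.\<close>
  have K\<gamma>: "4 / a * ?K * \<gamma> \<le> 8 / 3 - 46 * g"
  proof -
    have "?K * \<gamma> \<le> 2 / 3 * a - 23 / 2 * (a * g)" using c1 unfolding g_def by (simp add: algebra_simps)
    then have "4 / a * (?K * \<gamma>) \<le> 4 / a * (2 / 3 * a - 23 / 2 * (a * g))"
      using pos by (intro mult_left_mono) auto
    also have "\<dots> = 8 / 3 - 46 * g" using pos by (simp add: field_simps)
    finally show ?thesis by (simp only: mult.assoc)
  qed
  have "P * h\<^sub>0 \<le> h\<^sub>0" using pos mult_right_mono[of P 1 h\<^sub>0] by simp
  then have "h - 3 * (g * h) \<le> h\<^sub>0 + 3 * (g * h\<^sub>0) + 8 / 3 - 44 * g" using base K\<gamma> by linarith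
  moreover have "g * h\<^sub>0 \<le> h\<^sub>0 / 18" using mult_right_mono[OF g18 pos(7)] by simp
  \<comment> \<open>The factor 7/5 is \<open>(1 + 3 * g) / (1 - 3 * g)\<close> at the extreme value
    \<open>g = 1 / 18\<close>.\<close>
  moreover have "(1 - 3 * g) * (8 / 3 + 7 / 5 * h\<^sub>0) = 8 / 3 + 7 / 5 * h\<^sub>0 - 8 * g - 21 / 5 * (g * h\<^sub>0)"
    "(1 - 3 * g) * h = h - 3 * (g * h)" by (simp_all add: field_simps)
  ultimately have "(1 - 3 * g) * h \<le> (1 - 3 * g) * (8 / 3 + 7 / 5 * h\<^sub>0)"
    using g by linarith
  then have "h \<le> 8 / 3 + 7 / 5 * h\<^sub>0" using g18 by (simp add: mult_le_cancel_left)
  then have "g * h \<le> g * (8 / 3 + 7 / 5 * h\<^sub>0)" using g by (intro mult_left_mono) auto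
  moreover have gh0: "0 \<le> g * h\<^sub>0" using g pos by simp
  \<comment> \<open>The crude bound turns \<open>3 * (g * h)\<close> into
    \<open>8 * g + 21/5 * (g * h\<^sub>0)\<close>. Rounding 36/5 up to 9 matches
    \<open>3 * H * \<Delta>\<close> with \<open>\<Delta> \<ge> 3 * h\<^sub>0\<close>.\<close>
  ultimately have 1: "h \<le> P * h\<^sub>0 + (10 * g + 9 * (g * h\<^sub>0)) + 4 / a * ?K * \<gamma>"
    using base by (simp add: algebra_simps)
  \<comment> \<open>The summand \<open>5 / 2 * (a * H)\<close> is the term \<open>10 * g\<close>
    brought under the factor \<open>4 / a\<close>.\<close>
  have C1ge: "2 * C\<^sub>1 + a * H \<ge> ?K + 5 / 2 * (a * H)"
  proof -
    have "1 * (R * B + 4 * (B * H) + (1 + a) * H) \<le> s * (R * B + 4 * (B * H) + (1 + a) * H)"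
      using s pos by (intro mult_right_mono) auto
    then show ?thesis using pos unfolding C1 by (simp add: algebra_simps)
  qed
  have d0: "\<Delta> \<ge> 0" using \<Delta> pos by linarith
  have "?K + 5 / 2 * (a * H) \<le> 2 * (2 * \<sigma>\<^sup>2 + C\<^sub>1) + a * H + (C\<^sub>3 + 3 * a * H) * \<Delta>"
  proof -
    have "0 \<le> (C\<^sub>3 + 3 * a * H) * \<Delta>" using C3 pos d0 by auto
    then have "2 * C\<^sub>1 + a * H \<le> 2 * (2 * \<sigma>\<^sup>2 + C\<^sub>1) + a * H + (C\<^sub>3 + 3 * a * H) * \<Delta>"
      by (smt (verit) zero_le_power2)
    with C1ge show ?thesis by (rule order_trans)
  qed
  moreover have "4 / a \<le> 4 * s / a" using s pos by (intro divide_right_mono) auto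
  ultimately have 2: "4 / a * (?K + 5 / 2 * (a * H))
      \<le> 4 * s / a * (2 * (2 * \<sigma>\<^sup>2 + C\<^sub>1) + a * H + (C\<^sub>3 + 3 * a * H) * \<Delta>)"
    using pos s by (intro mult_mono) auto
  have 3: "9 * H * h\<^sub>0 \<le> 3 * H * \<Delta>" using mult_left_mono[OF \<Delta>, of "3 * H"] pos by simp
  have "(9 * H * h\<^sub>0 + 4 / a * (?K + 5 / 2 * (a * H))) * \<gamma>
    \<le> (3 * H * \<Delta> + 4 * s / a * (2 * (2 * \<sigma>\<^sup>2 + C\<^sub>1) + a * H + (C\<^sub>3 + 3 * a * H) * \<Delta>)) * \<gamma>"
    using add_mono[OF 3 2] pos by (intro mult_right_mono) auto
  moreover have "(9 * H * h\<^sub>0 + 4 / a * (?K + 5 / 2 * (a * H))) * \<gamma>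
      = (10 * g + 9 * (g * h\<^sub>0)) + 4 / a * ?K * \<gamma>"
    using pos by (simp add: g_def field_simps)
  ultimately show ?thesis using 1 by linarith
qed

section \<open>The convergence theorem\<close>

text \<open>Quotients by possibly zero constants are taken in \<open>ereal\<close>, where a positive
  number divided by 0 is \<infinity>. Integrability is stated in the conclusion, and in
  \<open>A4\<close>, because the Bochner integral of a non-integrable function is 0.\<close>

theorem theorem1:
  fixes Z :: "'b::euclidean_space set"
    and S :: "'b measure"
    and l :: "'a::euclidean_space \<Rightarrow> 'b \<Rightarrow> real"
    and G Gh :: "'a \<Rightarrow> 'b \<Rightarrow> 'a"
    and D :: "'a \<Rightarrow> 'b measure"
    and P :: "'a \<Rightarrow> 'b \<Rightarrow> 'b measure"
    and \<theta>\<^sub>P\<^sub>S \<theta>\<^sub>0 :: 'a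
    and \<gamma> :: "nat \<Rightarrow> real"
    and M :: "'w measure"
    and \<theta> :: "nat \<Rightarrow> 'w \<Rightarrow> 'a"
    and z :: "nat \<Rightarrow> 'w \<Rightarrow> 'b"
    and \<mu> L \<sigma> L\<^sub>P\<^sub>H \<epsilon> Lbar Lhat \<mu>t vsig C\<^sub>1 C\<^sub>2 C\<^sub>3 \<Delta> C :: real
  assumes Z: "Z \<in> sets borel" "S = restrict_space borel Z"
    and gradient: "\<And>\<theta> x. x \<in> Z \<Longrightarrow> GDERIV (\<lambda>t. l t x) \<theta> :> G \<theta> x"
    and kernel: "\<And>\<theta>. P \<theta> \<in> S \<rightarrow>\<^sub>M prob_algebra S"
    and D: "\<And>\<theta> p. stationary_distribution S (P \<theta>) p \<longleftrightarrow> p = D \<theta>"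
    and stable: "performatively_stable l D \<theta>\<^sub>P\<^sub>S"
    and A1: "\<mu> > 0"
      "\<And>\<theta> \<theta>' x. x \<in> Z \<Longrightarrow>
         l \<theta> x \<ge> l \<theta>' x + G \<theta>' x \<bullet> (\<theta> - \<theta>') + \<mu> / 2 * (norm (\<theta>' - \<theta>))\<^sup>2"
    and A2: "L \<ge> 0"
      "\<And>\<theta> \<theta>' x x'. x \<in> Z \<Longrightarrow> x' \<in> Z \<Longrightarrow>
         norm (G \<theta> x - G \<theta>' x') \<le> L * (norm (\<theta> - \<theta>') + norm (x - x'))"
    and A3: "\<sigma> \<ge> 0"
      "\<And>\<theta> x. x \<in> Z \<Longrightarrow> norm (G \<theta> x - mean_grad G D \<theta> \<theta>\<^sub>P\<^sub>S) \<le> \<sigma> * (1 + norm (\<theta> - \<theta>\<^sub>P\<^sub>S))"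
    and A4: "\<And>\<theta> \<theta>' x. x \<in> Z \<Longrightarrow> integrable (P \<theta> x) (Gh \<theta>')"
      "\<And>\<theta> \<theta>' x. x \<in> Z \<Longrightarrow>
         G \<theta>' x - mean_grad G D \<theta>' \<theta> = Gh \<theta>' x - kernel_apply (P \<theta>) (Gh \<theta>') x"
    and A5: "L\<^sub>P\<^sub>H \<ge> 0"
      "\<And>\<theta> \<theta>' x. x \<in> Z \<Longrightarrow>
         norm (kernel_apply (P \<theta>) (Gh \<theta>) x - kernel_apply (P \<theta>') (Gh \<theta>') x)
           \<le> L\<^sub>P\<^sub>H * norm (\<theta> - \<theta>')"
    and A6: "\<epsilon> \<ge> 0" "\<And>\<theta> \<theta>'. W1 (D \<theta>) (D \<theta>') \<le> ennreal (\<epsilon> * norm (\<theta> - \<theta>'))"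
    and Lbar: "Lbar > 0" "\<And>\<theta> x. x \<in> Z \<Longrightarrow> norm (G \<theta> x) \<le> Lbar * (1 + norm (\<theta> - \<theta>\<^sub>P\<^sub>S))"
    and Lhat: "Lhat > 0"
      "\<And>\<theta> x. x \<in> Z \<Longrightarrow>
         max (norm (Gh \<theta> x)) (norm (kernel_apply (P \<theta>) (Gh \<theta>) x))
           \<le> Lhat * (1 + norm (\<theta> - \<theta>\<^sub>P\<^sub>S))"
    and \<mu>t: "\<mu>t = \<mu> - L * \<epsilon>"
    and vsig: "vsig = 1 + \<gamma> 1 * \<mu>t / 4"
    and C\<^sub>1: "C\<^sub>1 = vsig * L\<^sub>P\<^sub>H * Lbar + 4 * vsig * Lbar * Lhat + (1 + \<mu>t) * vsig * Lhat"
    and C\<^sub>2: "C\<^sub>2 = 2 * vsig * L\<^sub>P\<^sub>H * Lbar"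
    and C\<^sub>3: "C\<^sub>3 = C\<^sub>1 + 2 * (1 + \<mu>t) * vsig * Lhat"
    and \<Delta>: "\<Delta> = 3 * (norm (\<theta>\<^sub>0 - \<theta>\<^sub>P\<^sub>S))\<^sup>2
          + vsig / (9 * Lhat\<^sup>2) * (2 * (2 * \<sigma>\<^sup>2 + C\<^sub>1) + (\<mu> - L * \<epsilon>) * Lhat)"
    and C: "C = 3 * Lhat * \<Delta>
          + 4 * vsig / (\<mu> - L * \<epsilon>) *
            (2 * (2 * \<sigma>\<^sup>2 + C\<^sub>1) + (\<mu> - L * \<epsilon>) * Lhat + (C\<^sub>3 + 3 * (\<mu> - L * \<epsilon>) * Lhat) * \<Delta>)"
    and \<epsilon>_small: "ereal \<epsilon> < ereal \<mu> / ereal L"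
    and \<gamma>_pos: "\<And>k. \<gamma> k > 0"
    and \<gamma>_mono: "\<And>i j. 1 \<le> i \<Longrightarrow> i \<le> j \<Longrightarrow> \<gamma> j \<le> \<gamma> i"
    and \<gamma>_ratio: "\<And>k. k \<ge> 1 \<Longrightarrow> \<gamma> (k - 1) / \<gamma> k \<le> 1 + \<gamma> k * (\<mu> - L * \<epsilon>) / 4"
    and \<gamma>_bound: "\<And>k. k \<ge> 1 \<Longrightarrow>
         ereal (\<gamma> k) \<le> Min {ereal (\<mu> - L * \<epsilon>) / ereal (2 * L\<^sup>2),
                             ereal (\<mu> - L * \<epsilon>) / ereal (2 * C\<^sub>2),
                             ereal (min ((\<mu> - L * \<epsilon>) / 3) (3 * Lhat))
                               / ereal (C\<^sub>3 + 3 * Lhat * (\<mu> - L * \<epsilon>)),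
                             1 / ereal (6 * Lhat)}"
    and process: "sa_process M S P G \<gamma> \<theta>\<^sub>0 \<theta> z"
  shows "\<forall>k\<ge>1. integrable M (\<lambda>\<omega>. (norm (\<theta> k \<omega> - \<theta>\<^sub>P\<^sub>S))\<^sup>2) \<and>
           (\<integral>\<omega>. (norm (\<theta> k \<omega> - \<theta>\<^sub>P\<^sub>S))\<^sup>2 \<partial>M)
             \<le> (\<Prod>i=1..k. 1 - \<gamma> i * (\<mu> - L * \<epsilon>) / 2) * (norm (\<theta>\<^sub>0 - \<theta>\<^sub>P\<^sub>S))\<^sup>2 + C * \<gamma> k"
proof -

  \<comment> \<open>The process and its probability space\<close>
  define a where "a = \<mu> - L * \<epsilon>"
  have spS: "space S = Z" using Z by (simp add: space_restrict_space)
  have prob: "prob_space M" and z: "\<And>k. z k \<in> M \<rightarrow>\<^sub>M S"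
    and \<theta>0: "\<And>\<omega>. \<omega> \<in> space M \<Longrightarrow> \<theta> 0 \<omega> = \<theta>\<^sub>0"
    and \<theta>Suc: "\<And>k \<omega>. \<omega> \<in> space M \<Longrightarrow> \<theta> (Suc k) \<omega> = \<theta> k \<omega> - \<gamma> (Suc k) *\<^sub>R G (\<theta> k \<omega>) (z (Suc k) \<omega>)"
    and law: "\<And>k A. A \<in> sets S \<Longrightarrow> AE \<omega> in M.
        real_cond_exp M (past M S z k) (indicator (z (Suc k) -` A \<inter> space M)) \<omega> =
        measure (P (\<theta> k \<omega>) (z k \<omega>)) A"
    using process unfolding sa_process_def by auto
  interpret prob_space M by (rule prob)
  have zZ: "z k \<omega> \<in> Z" if "\<omega> \<in> space M" for k \<omega> using measurable_space[OF z that] spS by simp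
  obtain x\<^sub>0 where x0: "x\<^sub>0 \<in> Z" using not_empty zZ by blast

  \<comment> \<open>Comparison of the constants and consequences of the step-size bounds\<close>
  have G_mono: "(G t x - G t' x) \<bullet> (t - t') \<ge> \<mu> * (norm (t - t'))\<^sup>2" if "x \<in> Z" for t t' x
    using A1(2)[OF that, of t t'] A1(2)[OF that, of t' t]
    by (simp add: inner_diff norm_minus_commute algebra_simps)
  \<comment> \<open>Strong monotonicity and the Lipschitz bound, compared along one unit vector. In
    particular \<open>L > 0\<close>, so the quotients by \<open>L\<close> are finite.\<close>
  have \<mu>L: "\<mu> \<le> L"
  proof -
    obtain b :: 'a where b: "b \<in> Basis" using nonempty_Basis by blast
    have "\<mu> * (norm (b - 0))\<^sup>2 \<le> norm (G b x\<^sub>0 - G 0 x\<^sub>0) * norm (b - 0)"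
      by (rule order_trans[OF G_mono[OF x0] norm_cauchy_schwarz])
    also have "\<dots> \<le> (L * (norm (b - 0) + norm (x\<^sub>0 - x\<^sub>0))) * norm (b - 0)"
      by (intro mult_right_mono A2(2) x0) simp
    finally show ?thesis using b by simp
  qed
  have L: "L > 0" using \<mu>L A1(1) by simp
  have a: "a > 0"
  proof -
    have "\<epsilon> < \<mu> / L" using \<epsilon>_small L by simp
    then show ?thesis using L by (simp add: a_def field_simps)
  qed
  have aL: "a \<le> L" using \<mu>L A2(1) A6(1) unfolding a_def by (smt (verit) mult_nonneg_nonneg)

  have s1: "vsig \<ge> 1" using vsig \<gamma>_pos[of 1] a by (simp add: \<mu>t a_def[symmetric])
  have step_bound: "ereal (\<gamma> k) \<le> e" if "k \<ge> 1" "e \<in> {ereal a / ereal (2 * L\<^sup>2), ereal a / ereal (2 * C\<^sub>2),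
       ereal (min (a / 3) (3 * Lhat)) / ereal (C\<^sub>3 + 3 * Lhat * a), 1 / ereal (6 * Lhat)}" for k e
    using \<gamma>_bound[OF that(1), folded a_def] by (rule order_trans) (intro Min_le that(2), simp)
  have \<gamma>L: "\<gamma> (Suc k) * L\<^sup>2 \<le> a / 2" for k
    using step_bound[of "Suc k" "ereal a / ereal (2 * L\<^sup>2)"] L by (simp add: field_simps)
  have LHB: "0 \<le> L\<^sub>P\<^sub>H * Lbar" "0 \<le> Lbar * Lhat" using A5(1) Lbar(1) Lhat(1) by auto
  have scale: "u \<le> vsig * u" if "0 \<le> u" for u using mult_right_mono[OF s1 that] by simp
  have c2: "4 * (\<gamma> (Suc k) * (L\<^sub>P\<^sub>H * Lbar)) \<le> a" for k
  proof -
    \<comment> \<open>If \<open>C\<^sub>2\<close> vanishes, the step-size bound is infinite and says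
      nothing, but the inequality is then trivial.\<close>
    have "\<gamma> (Suc k) * (2 * C\<^sub>2) \<le> a"
    proof (cases "C\<^sub>2 = 0")
      case False
      moreover have "C\<^sub>2 \<ge> 0" unfolding C\<^sub>2 using s1 LHB by (simp add: mult.assoc)
      ultimately have "C\<^sub>2 > 0" by simp
      then show ?thesis
        using step_bound[of "Suc k" "ereal a / ereal (2 * C\<^sub>2)"] by (simp add: field_simps)
    qed (use a in simp)
    moreover have "\<gamma> (Suc k) * (4 * (L\<^sub>P\<^sub>H * Lbar)) \<le> \<gamma> (Suc k) * (2 * C\<^sub>2)"
      using scale[OF LHB(1)] less_imp_le[OF \<gamma>_pos] unfolding C\<^sub>2 by (intro mult_left_mono) auto
    moreover have "\<gamma> (Suc k) * (4 * (L\<^sub>P\<^sub>H * Lbar)) = 4 * (\<gamma> (Suc k) * (L\<^sub>P\<^sub>H * Lbar))" by simp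
    ultimately show ?thesis by linarith
  qed
  have C3: "C\<^sub>3 + 3 * Lhat * a \<ge> L\<^sub>P\<^sub>H * Lbar + 4 * (Lbar * Lhat) + 6 * (a * Lhat)" "C\<^sub>3 \<ge> 0"
    "C\<^sub>3 + 3 * Lhat * a > 0"
  proof -
    have aH: "0 < a * Lhat" "0 < Lhat" using a Lhat(1) by auto
    \<comment> \<open>The term \<open>(1 + a) * Lhat\<close> comes once from
      \<open>C\<^sub>1\<close> and twice from \<open>C\<^sub>3\<close>; the extra
      \<open>3 * Lhat * a\<close> completes the \<open>6 * (a * Lhat)\<close> required by
      \<open>c1\<close>.\<close>
    have "C\<^sub>3 = vsig * (L\<^sub>P\<^sub>H * Lbar + 4 * (Lbar * Lhat) + 3 * (Lhat + a * Lhat))"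
      unfolding C\<^sub>3 C\<^sub>1 \<mu>t a_def[symmetric] by (simp add: algebra_simps)
    also have "\<dots> \<ge> L\<^sub>P\<^sub>H * Lbar + 4 * (Lbar * Lhat) + 3 * (Lhat + a * Lhat)"
      using LHB aH by (intro scale) simp
    finally show "C\<^sub>3 + 3 * Lhat * a \<ge> L\<^sub>P\<^sub>H * Lbar + 4 * (Lbar * Lhat) + 6 * (a * Lhat)" "C\<^sub>3 \<ge> 0"
      "C\<^sub>3 + 3 * Lhat * a > 0"
      using LHB aH by (simp_all add: algebra_simps)
  qed
  have c1: "\<gamma> (Suc k) * (L\<^sub>P\<^sub>H * Lbar) + 4 * (\<gamma> (Suc k) * (Lbar * Lhat)) + 6 * (a * (\<gamma> (Suc k) * Lhat)) \<le> a / 3" for k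
  proof -
    have "\<gamma> (Suc k) \<le> min (a / 3) (3 * Lhat) / (C\<^sub>3 + 3 * Lhat * a)"
      using step_bound[of "Suc k" "ereal (min (a / 3) (3 * Lhat)) / ereal (C\<^sub>3 + 3 * Lhat * a)"] C3(3)
      by (simp del: ereal_min)
    then have "\<gamma> (Suc k) * (C\<^sub>3 + 3 * Lhat * a) \<le> a / 3"
      using C3(3) by (simp add: pos_le_divide_eq)
    moreover have "\<gamma> (Suc k) * (L\<^sub>P\<^sub>H * Lbar + 4 * (Lbar * Lhat) + 6 * (a * Lhat)) \<le> \<gamma> (Suc k) * (C\<^sub>3 + 3 * Lhat * a)"
      using C3(1) less_imp_le[OF \<gamma>_pos] by (rule mult_left_mono)
    ultimately show ?thesis by (simp add: algebra_simps)
  qed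
  have y: "a * \<gamma> (Suc k) \<le> 1 / 2" "\<gamma> (Suc k) * \<mu> \<le> 1" for k
  proof -
    have "\<gamma> (Suc k) * L * L \<le> 1 / 2 * L" using \<gamma>L[of k] aL by (simp add: power2_eq_square)
    then have gL: "\<gamma> (Suc k) * L \<le> 1 / 2" using L by (rule mult_right_le_imp_le)
    have "\<gamma> (Suc k) * a \<le> \<gamma> (Suc k) * L" "\<gamma> (Suc k) * \<mu> \<le> \<gamma> (Suc k) * L"
      using aL \<mu>L less_imp_le[OF \<gamma>_pos] by (intro mult_left_mono; simp)+
    then show "a * \<gamma> (Suc k) \<le> 1 / 2" "\<gamma> (Suc k) * \<mu> \<le> 1" using gL by (simp_all add: mult.commute)
  qed
  have ratio: "\<gamma> (Suc k) \<le> \<gamma> (Suc (Suc k)) * (1 + \<gamma> (Suc (Suc k)) * a / 4)" for k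
    using \<gamma>_ratio[of "Suc (Suc k)"] \<gamma>_pos[of "Suc (Suc k)"] by (simp add: a_def[symmetric] field_simps)

  \<comment> \<open>Regularity of the mean gradient and drift towards the stable point\<close>
  have Pp: "P t x \<in> space (prob_algebra S)" if "x \<in> Z" for t x
    using measurable_space[OF kernel] that spS by simp
  have Dp: "D t \<in> space (prob_algebra S)" for t
    using D[of t "D t"] by (simp add: stationary_distribution_def)
  have Dprob: "prob_space (D t)" "space (D t) = Z" for t
    using Dp[of t] spS sets_eq_imp_space_eq by (auto simp: space_prob_algebra)
  have G_meas: "G t \<in> borel_measurable S" for t
  proof -
    have "L-lipschitz_on Z (G t)"
      using A2 by (intro lipschitz_onI) (auto simp: dist_norm, metis diff_self norm_zero add_0)
    then show ?thesis
      unfolding Z(2) by (intro borel_measurable_continuous_on_restrict lipschitz_on_continuous_on)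
  qed
  have G_int: "integrable (D t') (G t)" for t t'
    by (rule integrable_bounded_prob[OF Dp G_meas]) (use Lbar(2) spS in auto)
  have G_lip: "norm (G t x - G t' x) \<le> L * norm (t - t')" if "x \<in> Z" for t t' x
    using A2(2)[OF that that, of t t'] by simp
  have m_lip: "norm (mean_grad G D t u - mean_grad G D t' u) \<le> L * norm (t - t')" for t t' u
    unfolding mean_grad_def using G_lip Dprob(2)
    by (intro norm_integral_diff_le[OF Dprob(1) G_int G_int]) auto
  have m_shift: "norm (mean_grad G D t u - mean_grad G D t u') \<le> L * (\<epsilon> * norm (u - u'))" for t u u'
    unfolding mean_grad_def
  proof (rule norm_integral_diff_le_W1[OF Z(2) Dp Dp G_meas Lbar(2) L _ A6(2)])
    show "norm (G t x - G t y) \<le> L * norm (x - y)" if "x \<in> Z" "y \<in> Z" for x y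
      using A2(2)[OF that, of t t] by simp
  qed (use A6(1) in auto)
  \<comment> \<open>\<open>m\<close> averages the gradient over the distribution induced by the
    current parameter; \<open>m'\<close> freezes the distribution at the stable point and is
    strongly monotone.\<close>
  define m where "m t = mean_grad G D t t" for t
  define m' where "m' t = mean_grad G D t \<theta>\<^sub>P\<^sub>S" for t
  have m'_inner: "m' t \<bullet> v = (\<integral>x. G t x \<bullet> v \<partial>D \<theta>\<^sub>P\<^sub>S)" for t v
    unfolding m'_def mean_grad_def by (rule integral_inner_left[symmetric]) (rule G_int)
  interpret DPS: prob_space "D \<theta>\<^sub>P\<^sub>S" by (rule Dprob)
  have m'_mono: "(m' t - m' t') \<bullet> (t - t') \<ge> \<mu> * (norm (t - t'))\<^sup>2" for t t'
  proof -
    have "(m' t - m' t') \<bullet> (t - t') = (\<integral>x. (G t x - G t' x) \<bullet> (t - t') \<partial>D \<theta>\<^sub>P\<^sub>S)"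
      unfolding inner_diff_left m'_inner by (simp add: G_int)
    also have "\<dots> \<ge> (\<integral>x. \<mu> * (norm (t - t'))\<^sup>2 \<partial>D \<theta>\<^sub>P\<^sub>S)"
      by (rule integral_mono) (use G_mono Dprob(2) G_int in auto)
    finally show ?thesis by (simp add: DPS.prob_space)
  qed
  have m'_nonneg: "0 \<le> m' t \<bullet> (t - \<theta>\<^sub>P\<^sub>S)" for t
  proof -
    have l_int: "integrable (D \<theta>\<^sub>P\<^sub>S) (l u)" for u using stable by (simp add: performatively_stable_def)
    have "risk l D \<theta>\<^sub>P\<^sub>S \<theta>\<^sub>P\<^sub>S \<le> risk l D t \<theta>\<^sub>P\<^sub>S"
      using stable by (auto simp: performatively_stable_def is_arg_min_def not_less)
    then have "(\<integral>x. l \<theta>\<^sub>P\<^sub>S x \<partial>D \<theta>\<^sub>P\<^sub>S) \<le> (\<integral>x. l t x \<partial>D \<theta>\<^sub>P\<^sub>S)" by (simp add: risk_def)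
    \<comment> \<open>Convexity is used with base point \<open>t\<close>, not the minimiser, which
      yields the sign condition on \<open>m'\<close> at every \<open>t\<close>.\<close>
    moreover have "(\<integral>x. l t x + G t x \<bullet> (\<theta>\<^sub>P\<^sub>S - t) \<partial>D \<theta>\<^sub>P\<^sub>S) \<le> (\<integral>x. l \<theta>\<^sub>P\<^sub>S x \<partial>D \<theta>\<^sub>P\<^sub>S)"
    proof (rule integral_mono)
      fix x assume "x \<in> space (D \<theta>\<^sub>P\<^sub>S)"
      then have "x \<in> Z" using Dprob(2) by simp
      moreover have "0 \<le> \<mu> / 2 * (norm (t - \<theta>\<^sub>P\<^sub>S))\<^sup>2" using A1(1) by simp
      ultimately show "l t x + G t x \<bullet> (\<theta>\<^sub>P\<^sub>S - t) \<le> l \<theta>\<^sub>P\<^sub>S x" using A1(2)[of x t "\<theta>\<^sub>P\<^sub>S"] by linarith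
    qed (use l_int G_int in auto)
    ultimately have "m' t \<bullet> (\<theta>\<^sub>P\<^sub>S - t) \<le> 0"
      unfolding m'_inner using l_int G_int by simp
    then show ?thesis by (simp add: inner_diff_right)
  qed
  have m'_lip: "norm (m' t - m' u) \<le> L * norm (t - u)" for t u unfolding m'_def by (rule m_lip)
  have m'0: "m' \<theta>\<^sub>P\<^sub>S = 0" by (rule gradient_zero_if_minimal[OF m'_nonneg m'_lip])
  have drift: "norm (t - \<theta>\<^sub>P\<^sub>S - \<gamma> (Suc k) *\<^sub>R m t) \<le> (1 - 3 / 4 * (a * \<gamma> (Suc k))) * norm (t - \<theta>\<^sub>P\<^sub>S)" for t k
    unfolding a_def
  proof (rule gradient_step_contraction)
    show "m' t \<bullet> (t - \<theta>\<^sub>P\<^sub>S) \<ge> \<mu> * (norm (t - \<theta>\<^sub>P\<^sub>S))\<^sup>2" using m'_mono[of t "\<theta>\<^sub>P\<^sub>S"] m'0 by simp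
    show "norm (m' t) \<le> L * norm (t - \<theta>\<^sub>P\<^sub>S)" using m'_lip[of t "\<theta>\<^sub>P\<^sub>S"] m'0 by simp
    show "norm (m t - m' t) \<le> L * \<epsilon> * norm (t - \<theta>\<^sub>P\<^sub>S)"
      unfolding m_def m'_def using m_shift by (simp add: mult.assoc)
  qed (use \<gamma>L y(2) less_imp_le[OF \<gamma>_pos] in \<open>auto simp: a_def\<close>)

  \<comment> \<open>Bounds, measurability and Lipschitz continuity of the Poisson solution\<close>
  define U where "U t x = kernel_apply (P t) (Gh t) x" for t x
  have poisson: "G t x - m t = Gh t x - U t x" if "x \<in> Z" for t x
    unfolding m_def U_def by (rule A4(2)[OF that])
  have Gh_bound: "norm (Gh t x) \<le> Lhat * (1 + norm (t - \<theta>\<^sub>P\<^sub>S))"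
    and U_bound: "norm (U t x) \<le> Lhat * (1 + norm (t - \<theta>\<^sub>P\<^sub>S))" if "x \<in> Z" for t x
    using Lhat(2)[OF that, of t] unfolding U_def by auto
  \<comment> \<open>Integrability against the kernel at the single state \<open>x\<^sub>0\<close>
    already contains measurability, as that measure has the sigma-algebra of
    \<open>S\<close>.\<close>
  have Gh_meas: "Gh t \<in> borel_measurable S" for t
  proof -
    have "sets (P t x\<^sub>0) = sets S" using Pp[OF x0, of t] by (simp add: space_prob_algebra)
    from measurable_cong_sets[OF this refl] show ?thesis
      using borel_measurable_integrable[OF A4(1)[OF x0]] by blast
  qed
  have U_meas: "U t \<in> borel_measurable S" for t
  proof -
    have "(\<lambda>x. Gh t x - G t x + m t) \<in> borel_measurable S" using Gh_meas[of t] G_meas[of t] by measurable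
    then show ?thesis
      by (rule measurable_cong[THEN iffD1, rotated])
        (use poisson spS in \<open>auto simp: algebra_simps\<close>)
  qed
  have U_lip: "norm (U t x - U t' x) \<le> L\<^sub>P\<^sub>H * norm (t - t')" if "x \<in> Z" for t t' x
    unfolding U_def by (rule A5(2)[OF that])
  \<comment> \<open>One contribution each from \<open>U\<close> and \<open>G\<close>, and
    \<open>L + L * \<epsilon>\<close> from the mean gradient, whose argument and distribution both
    move.\<close>
  define K where "K = L\<^sub>P\<^sub>H + L + (L + L * \<epsilon>)"
  have K: "K \<ge> 0" using A5(1) A2(1) A6(1) by (simp add: K_def)
  have Gh_lip: "norm (Gh t x - Gh t' x) \<le> K * norm (t - t')" if x: "x \<in> Z" for t t' x
  proof -
    have "Gh t x - Gh t' x = (U t x - U t' x) + (G t x - G t' x) - (m t - m t')"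
      using poisson[OF x, of t] poisson[OF x, of t'] by (simp add: algebra_simps)
    moreover have "m t - m t' = (mean_grad G D t t - mean_grad G D t' t) + (mean_grad G D t' t - mean_grad G D t' t')"
      by (simp add: m_def)
    then have "norm (m t - m t') \<le> L * norm (t - t') + L * (\<epsilon> * norm (t - t'))"
      using norm_triangle_mono[OF m_lip m_shift] by metis
    ultimately have "norm (Gh t x - Gh t' x) \<le> L\<^sub>P\<^sub>H * norm (t - t') + L * norm (t - t')
        + (L * norm (t - t') + L * (\<epsilon> * norm (t - t')))"
      using norm_triangle_mono[OF U_lip[OF x, of t t'] G_lip[OF x, of t t']]
        norm_triangle_ineq4[of "(U t x - U t' x) + (G t x - G t' x)" "m t - m t'"] by simp
    then show ?thesis by (simp add: K_def algebra_simps)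
  qed

  \<comment> \<open>Measurability, adaptedness and boundedness of the iterates\<close>
  have comp_meas: "(\<lambda>\<omega>. V (T \<omega>) (X \<omega>)) \<in> borel_measurable F"
    if "T \<in> borel_measurable F" "X \<in> F \<rightarrow>\<^sub>M S" "\<And>t. V t \<in> borel_measurable S" "c \<ge> 0"
      "\<And>t t' x. x \<in> Z \<Longrightarrow> norm (V t x - V t' x) \<le> c * norm (t - t')"
    for T X and V :: "'a \<Rightarrow> 'b \<Rightarrow> 'a" and c and F :: "'w measure"
  proof (rule borel_measurable_Caratheodory[OF that(1,2,3)])
    fix x assume "x \<in> space S"
    then have "c-lipschitz_on UNIV (\<lambda>t. V t x)"
      using that(4,5) spS by (intro lipschitz_onI) (auto simp: dist_norm)
    then show "continuous_on UNIV (\<lambda>t. V t x)" by (rule lipschitz_on_continuous_on)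
  qed
  \<comment> \<open>With the sigma-algebra fixed at time \<open>j\<close>, the induction on
    \<open>k\<close> never compares sigma-algebras at different times.\<close>
  have adapted: "\<theta> k \<in> borel_measurable (past M S z j)" if "k \<le> j" for k j
    using that
  proof (induction k)
    case 0
    have "space (past M S z j) = space M" using past_subalgebra[OF z] by (simp add: subalgebra_def)
    then show ?case using \<theta>0 by (subst measurable_cong[of _ _ "\<lambda>_. \<theta>\<^sub>0"]) auto
  next
    case (Suc k)
    have sp: "space (past M S z j) = space M" using past_subalgebra[OF z] by (simp add: subalgebra_def)
    have [measurable]: "\<theta> k \<in> borel_measurable (past M S z j)" using Suc by simp
    have [measurable]: "(\<lambda>\<omega>. G (\<theta> k \<omega>) (z (Suc k) \<omega>)) \<in> borel_measurable (past M S z j)"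
      by (rule comp_meas[OF _ measurable_past[OF z Suc.prems] G_meas A2(1) G_lip]) measurable
    have "(\<lambda>\<omega>. \<theta> k \<omega> - \<gamma> (Suc k) *\<^sub>R G (\<theta> k \<omega>) (z (Suc k) \<omega>)) \<in> borel_measurable (past M S z j)"
      by measurable
    then show ?case using \<theta>Suc sp by (subst measurable_cong) auto
  qed
  have \<theta>_meas[measurable]: "\<theta> k \<in> borel_measurable M" for k
    by (rule measurable_from_subalg[OF past_subalgebra[OF z] adapted[OF order_refl]])
  \<comment> \<open>Linear growth of the gradient and the deterministic start bound each iterate
    surely. The constant depends on \<open>k\<close>, so it provides integrability but no
    rate.\<close>
  have "\<exists>c. \<forall>\<omega>\<in>space M. norm (\<theta> k \<omega> - \<theta>\<^sub>P\<^sub>S) \<le> c" for k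
  proof (induction k)
    case 0
    then show ?case using \<theta>0 by auto
  next
    case (Suc k)
    then obtain c where c: "\<And>\<omega>. \<omega> \<in> space M \<Longrightarrow> norm (\<theta> k \<omega> - \<theta>\<^sub>P\<^sub>S) \<le> c" by blast
    have "norm (\<theta> (Suc k) \<omega> - \<theta>\<^sub>P\<^sub>S) \<le> c + \<gamma> (Suc k) * (Lbar * (1 + c))" if w: "\<omega> \<in> space M" for \<omega>
    proof -
      have "norm (\<theta> (Suc k) \<omega> - \<theta>\<^sub>P\<^sub>S) \<le> norm (\<theta> k \<omega> - \<theta>\<^sub>P\<^sub>S) + norm (\<gamma> (Suc k) *\<^sub>R G (\<theta> k \<omega>) (z (Suc k) \<omega>))"
        unfolding \<theta>Suc[OF w]
        using norm_triangle_ineq4[of "\<theta> k \<omega> - \<theta>\<^sub>P\<^sub>S" "\<gamma> (Suc k) *\<^sub>R G (\<theta> k \<omega>) (z (Suc k) \<omega>)"]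
        by (simp add: algebra_simps)
      also have "norm (\<gamma> (Suc k) *\<^sub>R G (\<theta> k \<omega>) (z (Suc k) \<omega>)) \<le> \<gamma> (Suc k) * (Lbar * (1 + c))"
      proof -
        have "norm (G (\<theta> k \<omega>) (z (Suc k) \<omega>)) \<le> Lbar * (1 + norm (\<theta> k \<omega> - \<theta>\<^sub>P\<^sub>S))"
          by (rule Lbar(2)[OF zZ[OF w]])
        also have "\<dots> \<le> Lbar * (1 + c)" using c[OF w] Lbar(1) by (intro mult_left_mono) auto
        finally show ?thesis using \<gamma>_pos[of "Suc k"] by (simp add: mult_left_mono)
      qed
      finally show ?thesis using c[OF w] by linarith
    qed
    then show ?case by blast
  qed
  then obtain c where c: "\<And>k \<omega>. \<omega> \<in> space M \<Longrightarrow> norm (\<theta> k \<omega> - \<theta>\<^sub>P\<^sub>S) \<le> c k" by metis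

  define e where "e k \<omega> = \<theta> k \<omega> - \<theta>\<^sub>P\<^sub>S" for k \<omega>
  have e_meas[measurable]: "e k \<in> borel_measurable M" for k unfolding e_def by measurable
  have e_bound: "norm (e k \<omega>) \<le> c k" if "\<omega> \<in> space M" for k \<omega> using c[OF that] by (simp add: e_def)
  have c0: "0 \<le> c k" for k using e_bound not_empty norm_ge_zero order_trans by blast
  have U_comp[measurable]: "(\<lambda>\<omega>. U (\<theta> k \<omega>) (z j \<omega>)) \<in> borel_measurable M" for k j
    by (rule comp_meas[OF \<theta>_meas z U_meas A5(1) U_lip])
  have Gh_comp[measurable]: "(\<lambda>\<omega>. Gh (\<theta> k \<omega>) (z j \<omega>)) \<in> borel_measurable M" for k j
    by (rule comp_meas[OF \<theta>_meas z Gh_meas K Gh_lip])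
  have comp_bound: "norm (U (\<theta> k \<omega>) (z j \<omega>)) \<le> Lhat * (1 + c k)"
    "norm (Gh (\<theta> k \<omega>) (z j \<omega>)) \<le> Lhat * (1 + c k)" if "\<omega> \<in> space M" for k j \<omega>
  proof -
    have "Lhat * (1 + norm (\<theta> k \<omega> - \<theta>\<^sub>P\<^sub>S)) \<le> Lhat * (1 + c k)"
      using c[OF that] Lhat(1) by (intro mult_left_mono) auto
    then show "norm (U (\<theta> k \<omega>) (z j \<omega>)) \<le> Lhat * (1 + c k)"
      "norm (Gh (\<theta> k \<omega>) (z j \<omega>)) \<le> Lhat * (1 + c k)"
      using U_bound[OF zZ[OF that]] Gh_bound[OF zZ[OF that]] order_trans by blast+
  qed
  have inner_int: "integrable M (\<lambda>\<omega>. e k \<omega> \<bullet> V \<omega>)"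
    if [measurable]: "V \<in> borel_measurable M" and V: "\<And>\<omega>. \<omega> \<in> space M \<Longrightarrow> norm (V \<omega>) \<le> b" for k V b
  proof (rule integrable_const_bound[of _ "c k * b"])
    have "norm (e k \<omega> \<bullet> V \<omega>) \<le> c k * b" if "\<omega> \<in> space M" for \<omega>
      unfolding real_norm_def
      by (rule order_trans[OF Cauchy_Schwarz_ineq2]) (intro mult_mono e_bound V that c0 norm_ge_zero)
    then show "AE \<omega> in M. norm (e k \<omega> \<bullet> V \<omega>) \<le> c k * b" by auto
  qed measurable
  have eU_int: "integrable M (\<lambda>\<omega>. e k \<omega> \<bullet> U (\<theta> k \<omega>) (z j \<omega>))" for k j
    by (rule inner_int[OF U_comp comp_bound(1)])
  have eGh_int: "integrable M (\<lambda>\<omega>. e k \<omega> \<bullet> Gh (\<theta> k \<omega>) (z j \<omega>))" for k j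
    by (rule inner_int[OF Gh_comp comp_bound(2)])
  have e2_int: "integrable M (\<lambda>\<omega>. (norm (e k \<omega>))\<^sup>2)" for k
    unfolding power2_norm_eq_inner by (rule inner_int[OF e_meas e_bound])

  \<comment> \<open>The zero-mean part of the noise\<close>
  have martingale: "(\<integral>\<omega>. e k \<omega> \<bullet> Gh (\<theta> k \<omega>) (z (Suc k) \<omega>) \<partial>M) = (\<integral>\<omega>. e k \<omega> \<bullet> U (\<theta> k \<omega>) (z k \<omega>) \<partial>M)" for k
  proof -
    interpret finite_measure_subalgebra M "past M S z k"
      by unfold_locales (rule past_subalgebra[OF z])
    show ?thesis
    proof (rule integral_inner_kernel_parameter[OF z adapted[OF order_refl], where \<kappa> = "\<lambda>\<omega>. P (\<theta> k \<omega>) (z k \<omega>)"])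
      show "P (\<theta> k \<omega>) (z k \<omega>) \<in> space (prob_algebra S)" if "\<omega> \<in> space M" for \<omega>
        by (rule Pp[OF zZ[OF that]])
      show "e k \<in> borel_measurable (past M S z k)"
        unfolding e_def using adapted[OF order_refl, of k] by measurable
      show "norm (Gh t x) \<le> Lhat * (1 + norm (t - \<theta>\<^sub>P\<^sub>S))" if "x \<in> space S" for t x
        using Gh_bound that spS by simp
      show "norm (Gh t x - Gh t' x) \<le> K * dist t t'" if "x \<in> space S" for t t' x
        using Gh_lip that spS by (simp add: dist_norm)
    qed (use law Gh_meas K comp_bound e_bound U_comp in \<open>auto simp: U_def kernel_apply_def\<close>)
  qed

  \<comment> \<open>The Lyapunov function and its recursion\<close>
  define T where "T k \<omega> = e k \<omega> \<bullet> U (\<theta> k \<omega>) (z k \<omega>)" for k \<omega>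
  \<comment> \<open>\<open>\<gamma> 0\<close> may be smaller than \<open>\<gamma> 1\<close>, so it cannot serve as the weight at time \<open>0\<close>.\<close>
  define \<Gamma> where "\<Gamma> k = (if k = 0 then \<gamma> 1 else \<gamma> k)" for k
  define \<Phi> where "\<Phi> k = (\<integral>\<omega>. (norm (e k \<omega>))\<^sup>2 - 2 * \<Gamma> k * T k \<omega> \<partial>M)" for k
  define Kc where "Kc = 8 * (Lbar * Lhat) + 2 * (L\<^sub>P\<^sub>H * Lbar) + a * Lhat / 2"
  have T_int: "integrable M (T k)" for k unfolding T_def by (rule eU_int)
  have \<Gamma>: "\<gamma> (Suc k) \<le> \<Gamma> k" "\<Gamma> k \<le> \<gamma> (Suc k) * (1 + \<gamma> (Suc k) * a / 4)" for k
    using \<gamma>_mono[of k "Suc k"] ratio[of "k - 1"] \<gamma>_pos[of 1] a by (auto simp: \<Gamma>_def)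
  have step: "\<Phi> (Suc k) \<le> (1 - \<gamma> (Suc k) * a / 2) * \<Phi> k + (\<gamma> (Suc k))\<^sup>2 * Kc" for k
  proof -
    let ?g = "\<gamma> (Suc k)"
    let ?N = "\<lambda>\<omega>. e k \<omega> \<bullet> (Gh (\<theta> k \<omega>) (z (Suc k) \<omega>) - U (\<theta> k \<omega>) (z k \<omega>))"
    have N_int: "integrable M ?N" unfolding inner_diff_right using eGh_int eU_int by simp
    have N0: "(\<integral>\<omega>. ?N \<omega> \<partial>M) = 0" unfolding inner_diff_right using eGh_int eU_int martingale by simp
    have "\<Phi> (Suc k) \<le> (\<integral>\<omega>. (1 - ?g * a / 2) * ((norm (e k \<omega>))\<^sup>2 - 2 * \<Gamma> k * T k \<omega>) - 2 * ?g * ?N \<omega> + ?g\<^sup>2 * Kc \<partial>M)"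
      unfolding \<Phi>_def
    proof (rule integral_mono)
      fix \<omega> assume w: "\<omega> \<in> space M"
      note zw = zZ[OF w]
      let ?G = "G (\<theta> k \<omega>) (z (Suc k) \<omega>)"
      have eS: "e (Suc k) \<omega> = e k \<omega> - ?g *\<^sub>R ?G" by (simp add: e_def \<theta>Suc[OF w])
      have "norm (U (\<theta> k \<omega>) (z (Suc k) \<omega>) - U (\<theta> (Suc k) \<omega>) (z (Suc k) \<omega>)) \<le> L\<^sub>P\<^sub>H * norm (?g *\<^sub>R ?G)"
        using U_lip[OF zw, of "\<theta> k \<omega>" "Suc k" "\<theta> (Suc k) \<omega>"] \<theta>Suc[OF w] by simp
      from lyapunov_step[OF poisson[OF zw] drift[of "\<theta> k \<omega>" k] Lbar(2)[OF zw] Gh_bound[OF zw]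
          U_bound[OF zw] U_bound[OF zw] this a \<gamma>_pos _ _ A5(1) y(1) c1 c2 \<Gamma>, of k]
      show "(norm (e (Suc k) \<omega>))\<^sup>2 - 2 * \<Gamma> (Suc k) * T (Suc k) \<omega>
        \<le> (1 - ?g * a / 2) * ((norm (e k \<omega>))\<^sup>2 - 2 * \<Gamma> k * T k \<omega>) - 2 * ?g * ?N \<omega> + ?g\<^sup>2 * Kc"
        unfolding T_def eS using Lbar(1) Lhat(1) by (simp add: \<Gamma>_def Kc_def e_def)
    qed (use e2_int T_int N_int in auto)
    also have "\<dots> = (1 - ?g * a / 2) * \<Phi> k + ?g\<^sup>2 * Kc"
      unfolding \<Phi>_def using e2_int[of k] T_int[of k] N_int N0 by (simp add: prob_space)
    finally show ?thesis .
  qed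

  \<comment> \<open>Return from the Lyapunov function to the mean squared error\<close>
  define h where "h k = (\<integral>\<omega>. (norm (e k \<omega>))\<^sup>2 \<partial>M)" for k
  have \<Phi>_eq: "\<Phi> k = h k - 2 * \<Gamma> k * (\<integral>\<omega>. T k \<omega> \<partial>M)" for k
    unfolding \<Phi>_def h_def using e2_int T_int by simp
  \<comment> \<open>Young's inequality makes the bound affine in the squared error, so its
    expectation is expressed through \<open>h k\<close> alone.\<close>
  have T_bound: "\<bar>\<integral>\<omega>. T k \<omega> \<partial>M\<bar> \<le> Lhat * (1 / 2 + 3 / 2 * h k)" for k
  proof -
    have "\<bar>\<integral>\<omega>. T k \<omega> \<partial>M\<bar> \<le> (\<integral>\<omega>. \<bar>T k \<omega>\<bar> \<partial>M)" by (rule integral_abs_bound)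
    also have "\<dots> \<le> (\<integral>\<omega>. Lhat * (1 / 2 + 3 / 2 * (norm (e k \<omega>))\<^sup>2) \<partial>M)"
    proof (rule integral_mono)
      fix \<omega> assume w: "\<omega> \<in> space M"
      let ?x = "norm (e k \<omega>)"
      have "\<bar>T k \<omega>\<bar> \<le> ?x * norm (U (\<theta> k \<omega>) (z k \<omega>))" unfolding T_def by (rule Cauchy_Schwarz_ineq2)
      also have "\<dots> \<le> ?x * (Lhat * (1 + ?x))"
        using U_bound[OF zZ[OF w]] by (intro mult_left_mono) (auto simp: e_def)
      also have "\<dots> = Lhat * (?x * (1 + ?x))" by simp
      also have "?x * (1 + ?x) \<le> 1 / 2 + 3 / 2 * ?x\<^sup>2"
        using zero_le_power2[of "?x - 1"] by (simp add: power2_eq_square algebra_simps)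
      finally show "\<bar>T k \<omega>\<bar> \<le> Lhat * (1 / 2 + 3 / 2 * ?x\<^sup>2)" using Lhat(1) by simp
    qed (use T_int e2_int in auto)
    also have "\<dots> = Lhat * (1 / 2 + 3 / 2 * h k)"
      unfolding h_def using e2_int[of k] by (simp add: prob_space)
    finally show ?thesis .
  qed
  have h0: "h 0 = (norm (\<theta>\<^sub>0 - \<theta>\<^sub>P\<^sub>S))\<^sup>2"
  proof -
    have "h 0 = (\<integral>\<omega>. (norm (\<theta>\<^sub>0 - \<theta>\<^sub>P\<^sub>S))\<^sup>2 \<partial>M)"
      unfolding h_def e_def by (rule Bochner_Integration.integral_cong) (auto simp: \<theta>0)
    then show ?thesis by (simp add: prob_space)
  qed
  have Kc: "Kc \<ge> 0" unfolding Kc_def using LHB a Lhat(1) by simp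
  have \<Delta>': "\<Delta> \<ge> 3 * h 0"
  proof -
    have "0 \<le> C\<^sub>1"
      unfolding C\<^sub>1 \<mu>t a_def[symmetric] using s1 a A5(1) Lbar(1) Lhat(1) by (intro add_nonneg_nonneg mult_nonneg_nonneg) auto
    then have "0 \<le> vsig / (9 * Lhat\<^sup>2) * (2 * (2 * \<sigma>\<^sup>2 + C\<^sub>1) + a * Lhat)"
      using s1 a Lhat(1) by (intro mult_nonneg_nonneg add_nonneg_nonneg divide_nonneg_nonneg) auto
    then show ?thesis unfolding \<Delta> h0 a_def by simp
  qed
  have main: "h (Suc k) \<le> (\<Prod>i=1..Suc k. 1 - \<gamma> i * a / 2) * h 0 + C * \<gamma> (Suc k)" for k
  proof -
    let ?P = "\<Prod>i=1..Suc k. 1 - \<gamma> i * a / 2"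
    have fac: "0 \<le> 1 - \<gamma> i * a / 2 \<and> 1 - \<gamma> i * a / 2 \<le> 1" if "i \<in> {1..Suc k}" for i
      using that y(1)[of "i - 1"] \<gamma>_pos[of i] a by (auto simp: mult.commute)
    have P: "0 \<le> ?P" "?P \<le> 1" using fac by (auto intro!: prod_nonneg prod_le_1 simp del: prod.cl_ivl_Suc)
    have rec: "h (Suc k) - 2 * \<gamma> (Suc k) * (\<integral>\<omega>. T (Suc k) \<omega> \<partial>M)
        \<le> ?P * (h 0 - 2 * \<gamma> 1 * (\<integral>\<omega>. T 0 \<omega> \<partial>M)) + 4 / a * Kc * \<gamma> (Suc k)"
      using contraction_recursion[of \<Phi> \<gamma> a Kc, OF step a Kc \<gamma>_pos y(1) ratio, of k]
      unfolding \<Phi>_eq by (simp add: \<Gamma>_def del: prod.cl_ivl_Suc)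
    have hn: "h 0 \<ge> 0" by (simp add: h0)
    have "h (Suc k) \<le> ?P * h 0 + (3 * Lhat * \<Delta> + 4 * vsig / a *
            (2 * (2 * \<sigma>\<^sup>2 + C\<^sub>1) + a * Lhat + (C\<^sub>3 + 3 * a * Lhat) * \<Delta>)) * \<gamma> (Suc k)"
      by (rule final_estimate[OF a \<gamma>_pos \<gamma>_pos Lhat(1) less_imp_le[OF Lbar(1)] A5(1) hn P s1
            rec[unfolded Kc_def] T_bound T_bound prod_contraction_le[where \<gamma> = \<gamma>, OF a \<gamma>_pos y(1) ratio] c1
            C\<^sub>1[unfolded \<mu>t, folded a_def] C3(2) \<Delta>'])
    then show ?thesis unfolding C a_def .
  qed
  show ?thesis
  proof (intro allI impI)
    fix k :: nat assume "1 \<le> k"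
    then obtain j where "k = Suc j" by (cases k) auto
    then show "integrable M (\<lambda>\<omega>. (norm (\<theta> k \<omega> - \<theta>\<^sub>P\<^sub>S))\<^sup>2) \<and>
           (\<integral>\<omega>. (norm (\<theta> k \<omega> - \<theta>\<^sub>P\<^sub>S))\<^sup>2 \<partial>M)
             \<le> (\<Prod>i=1..k. 1 - \<gamma> i * (\<mu> - L * \<epsilon>) / 2) * (norm (\<theta>\<^sub>0 - \<theta>\<^sub>P\<^sub>S))\<^sup>2 + C * \<gamma> k"
      using e2_int[of k] main[of j] unfolding h0[symmetric] by (simp add: h_def e_def a_def)
  qed
qed

end
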